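(* Suppose that $S=\{t^*\}$ is a singleton, that $\sup_{t\in T}\mathrm{E}\left[l^2(\xi-t)\right]<+\infty$, and that there exists a random variable $K(\xi)$ with $\mathrm{E}[K(\xi)^2]<\infty$ such that $|l(\xi-t_1)-l(\xi-t_2)|\le K(\xi)|t_1-t_2|$ for all $t_1,t_2\in T$ and a.e. $\xi$. Suppose further that $l(\xi-t)$ is continuously differentiable with probability 1 and that $\left.\frac{d}{dt}\mathrm{E}[l'(\xi-t)]\right|_{t=t^*}<0$. Then, as $n\to\infty$, $$\sqrt{n}\,(t_n-t^* )\Rightarrow N(0,\sigma^2),\qquad \sigma^2=\frac{\mathrm{Var}\left[l'(\xi-t^* )\right]}{\left[\left.\frac{d}{dt}\mathrm{E}[l'(\xi-t)]\right|_{t=t^*}\right]^2}.$$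
   Context: Let $u$ be a proper closed concave nondecreasing utility function with $u(0)=0$ and $1\in\partial u(0)$ (subdifferential), and let $l(z)=-u(-z)$ (so $l$ is proper, closed, convex and nondecreasing). Let $\xi$ be a real random variable (the random loss), let $T\subset\mathbb{R}$ be a compact interval that is specified reasonably (it stands in for $\mathbb{R}$), and let $S$ be the set of optimal solutions of $$\min_{t\in T}\ t+\mathrm{E}[l(\xi-t)],$$ whose optimal value is the optimized certainty equivalent (OCE) risk measure. Let $\xi_1,\xi_2,\ldots$ be i.i.d. observations of $\xi$, and let $t_n$ be an optimal solution of the sample average approximation $$\min_{t\in T}\ t+\frac1n\sum_{i=1}^n l(\xi_i-t).$$ The symbol $\Rightarrow$ denotes convergence in distribution. *)

theory Defs
  imports "HOL-Probability.Probability"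
begin

definition hypograph :: "(real \<Rightarrow> ereal) \<Rightarrow> (real \<times> real) set" where
  "hypograph f = {(x, r). ereal r \<le> f x}"

text \<open>An extended-valued concave function is proper if it is nowhere \<open>\<infinity>\<close> and somewhere finite;
  it is closed if it is upper semicontinuous, i.e. if its hypograph is closed.\<close>

definition proper_closed_concave :: "(real \<Rightarrow> ereal) \<Rightarrow> bool" where
  "proper_closed_concave f \<longleftrightarrow>
     (\<forall>x. f x \<noteq> \<infinity>) \<and> (\<exists>x. f x \<noteq> -\<infinity>) \<and> closed (hypograph f) \<and> convex (hypograph f)"

definition concave_subdifferential :: "(real \<Rightarrow> ereal) \<Rightarrow> real \<Rightarrow> real set" where
  "concave_subdifferential f x = {g. \<forall>y. f y \<le> f x + ereal (g * (y - x))}"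

text \<open>Where both parts are infinite, \<open>\<infinity> - \<infinity> = \<infinity>\<close> in \<^typ>\<open>ereal\<close>,
  the usual convention for minimization.\<close>

definition ext_expectation :: "'a measure \<Rightarrow> ('a \<Rightarrow> ereal) \<Rightarrow> ereal" where
  "ext_expectation M X =
     enn2ereal (\<integral>\<^sup>+ \<omega>. e2ennreal (X \<omega>) \<partial>M) - enn2ereal (\<integral>\<^sup>+ \<omega>. e2ennreal (- X \<omega>) \<partial>M)"

text \<open>Meaningful only where \<open>f\<close> is finite in a neighbourhood; elsewhere a junk value.\<close>

definition ext_deriv :: "(real \<Rightarrow> ereal) \<Rightarrow> real \<Rightarrow> real" where
  "ext_deriv f = deriv (\<lambda>x. real_of_ereal (f x))"

text \<open>Finiteness has to be required separately, because \<^const>\<open>real_of_ereal\<close> maps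
  \<open>\<infinity>\<close> to \<open>0\<close> and could hide the edge of the effective domain.\<close>

definition continuously_differentiable_at :: "(real \<Rightarrow> ereal) \<Rightarrow> real \<Rightarrow> bool" where
  "continuously_differentiable_at f x \<longleftrightarrow>
     (\<forall>\<^sub>F y in nhds x. \<bar>f y\<bar> \<noteq> \<infinity> \<and> (\<lambda>z. real_of_ereal (f z)) field_differentiable at y) \<and>
     isCont (ext_deriv f) x"

definition oce_objective :: "'a measure \<Rightarrow> (real \<Rightarrow> ereal) \<Rightarrow> ('a \<Rightarrow> real) \<Rightarrow> real \<Rightarrow> ereal" where
  "oce_objective M l \<xi> t = ereal t + ext_expectation M (\<lambda>\<omega>. l (\<xi> \<omega> - t))"

text \<open>The observations are \<open>x 1, \<dots>, x n\<close>; the value \<open>x 0\<close> is unused.\<close>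

definition saa_objective :: "(real \<Rightarrow> ereal) \<Rightarrow> (nat \<Rightarrow> real) \<Rightarrow> nat \<Rightarrow> real \<Rightarrow> ereal" where
  "saa_objective l x n t = ereal t + ereal (1 / real n) * (\<Sum>i = 1..n. l (x i - t))"

text \<open>The normal law as an image of the standard one, so that variance \<open>0\<close> gives a point mass
  (with \<^const>\<open>normal_density\<close> it would give the null measure).\<close>

definition normal_law :: "real \<Rightarrow> real \<Rightarrow> real measure" where
  "normal_law m v = distr std_normal_distribution borel (\<lambda>x. m + sqrt v * x)"

end

theory Submission
  imports Defs
begin

text \<open>Convexity reduces the asymptotics of the minimizer to the central limit theorem for one sum at a
  time. If \<open>h\<close> selects a subgradient of \<open>l\<close> at each point, then \<open>1 - h (x - s)\<close> is a subgradient of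
  \<open>t \<mapsto> t + l (x - t)\<close> at \<open>s\<close>. Summed over the sample, it is a subgradient of the sample objective up
  to a factor, so its sign tells on which side of \<open>s\<close> the minimizer \<open>t\<^sub>n\<close> lies
  (\<open>saa_minimizer_score\<close>).

  Fix a real \<open>x\<close> and take \<open>s\<^sub>n = t\<^sup>* + x / sqrt n\<close>. With \<open>\<psi> t = E [h (\<xi> - t)]\<close>, let \<open>Z\<^sub>n\<close> be the centred
  and normalized sum of the \<open>h (\<xi>\<^sub>i - s\<^sub>n)\<close>, and let \<open>c\<^sub>n = sqrt n * (1 - \<psi> s\<^sub>n)\<close>. Up to ties, the event
  \<open>sqrt n * (t\<^sub>n - t\<^sup>*) \<le> x\<close> is the event \<open>Z\<^sub>n \<le> c\<^sub>n\<close>. The first-order condition at the interior point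
  \<open>t\<^sup>*\<close> says \<open>\<psi> t\<^sup>* = 1\<close> (\<open>expected_score_eq_1\<close>), hence \<open>c\<^sub>n\<close> tends to \<open>- D * x\<close>. Differentiability at
  \<open>\<xi> - t\<^sup>*\<close> and the Lipschitz bound make \<open>h (\<xi> - s\<^sub>n)\<close> converge to \<open>h (\<xi> - t\<^sup>*)\<close> in \<open>L\<^sup>2\<close>, so \<open>Z\<^sub>n\<close> converges in
  distribution to the centred normal law whose variance is that of \<open>h (\<xi> - t\<^sup>*)\<close>
  (\<open>clt_drifting_functions\<close>). Solving \<open>Z \<le> - D * x\<close> for \<open>x\<close> divides this law by \<open>- D > 0\<close>
  (\<open>weak_conv_m_by_inversion\<close>).

  Convexity thus turns local information near \<open>t\<^sup>*\<close> into a statement on the position of the global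
  minimizer, so that consistency of \<open>t\<^sub>n\<close> comes out together with its rate.\<close>

section \<open>Subgradients of a convex loss\<close>

text \<open>The facts about the loss that the asymptotics rest on; infinite values of \<open>l\<close> are admitted to
  the right of its effective domain.\<close>

locale extended_convex_loss =
  fixes l :: "real \<Rightarrow> ereal"
  assumes not_MInfty: "\<And>z. l z \<noteq> -\<infinity>"
    and mono: "mono l"
    and convex: "convex_on {z. l z \<noteq> \<infinity>} (\<lambda>z. real_of_ereal (l z))"
begin

definition edom :: "real set" where "edom = {z. l z \<noteq> \<infinity>}"

definition fin_loss :: "real \<Rightarrow> real" where "fin_loss z = real_of_ereal (l z)"

text \<open>An arbitrary selection of subgradients, a stand-in for \<open>l'\<close> that is defined at kinks as well.
  Whereas a statement such as differentiability at \<open>\<xi> - t\<close> for almost all \<open>\<xi>\<close> does not pass to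
  other variables with the same law unless the set of points involved is measurable, the subgradient
  inequality holds at every point of the interior of the domain.\<close>

definition score :: "real \<Rightarrow> real" where
  "score z = (if z \<in> interior edom then SOME d. \<forall>y\<in>edom. fin_loss z + d * (y - z) \<le> fin_loss y else 0)"

lemma convex_fin_loss: "convex_on edom fin_loss"
  using convex by (simp add: edom_def fin_loss_def[abs_def])

lemma l_eq_fin_loss: "z \<in> edom \<Longrightarrow> l z = ereal (fin_loss z)"
  using not_MInfty[of z] by (cases "l z") (auto simp: edom_def fin_loss_def)

lemma is_interval_edom: "is_interval edom"
  using convex_fin_loss by (simp add: convex_on_def is_interval_convex_1)

lemma score_subgradient_edom:
  assumes "z \<in> interior edom" "y \<in> edom"
  shows "fin_loss z + score z * (y - z) \<le> fin_loss y"
proof -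
  have "\<exists>d. \<forall>y\<in>edom. fin_loss z + d * (y - z) \<le> fin_loss y"
    using convex_le_Inf_differential[OF convex_fin_loss assms(1)] by blast
  from someI_ex[OF this] show ?thesis
    using assms by (simp add: score_def)
qed

lemma score_subgradient:
  assumes "z \<in> interior edom"
  shows "ereal (fin_loss z + score z * (y - z)) \<le> l y"
proof (cases "y \<in> edom")
  case True
  then show ?thesis
    using score_subgradient_edom[OF assms True] by (simp add: l_eq_fin_loss)
qed (simp add: edom_def)

text \<open>Adding the subgradient inequalities at two points gives monotonicity, whatever the selection.
  This is what makes the selection Borel measurable.\<close>

lemma mono_on_score: "mono_on (interior edom) score"
proof (rule mono_onI)
  fix z w assume z: "z \<in> interior edom" and w: "w \<in> interior edom" and "z \<le> w"
  have "score z * (w - z) \<le> score w * (w - z)"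
    using score_subgradient_edom[OF z, of w] score_subgradient_edom[OF w, of z] z w interior_subset
    by (force simp: algebra_simps)
  then show "score z \<le> score w"
    using \<open>z \<le> w\<close> by (cases "z = w") auto
qed

lemma borel_edom [measurable]: "edom \<in> sets borel"
  by (rule real_interval_borel_measurable) (rule is_interval_edom)

lemma score_borel [measurable]: "score \<in> borel_measurable borel"
proof -
  have "score \<in> borel_measurable (restrict_space borel (interior edom))"
    by (rule borel_measurable_mono_on_fnc[OF mono_on_score])
  then have "(\<lambda>z. indicator (interior edom) z *\<^sub>R score z) \<in> borel_measurable borel"
    by (subst borel_measurable_restrict_space_iff[symmetric]) auto
  moreover have "(\<lambda>z. indicator (interior edom) z *\<^sub>R score z) = score"
    by (auto simp: score_def indicator_def)
  ultimately show ?thesis by simp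
qed

lemma fin_loss_borel [measurable]: "fin_loss \<in> borel_measurable borel"
proof -
  have "mono_on edom fin_loss"
  proof (rule mono_onI)
    fix z w assume "z \<in> edom" "w \<in> edom" "z \<le> w"
    then show "fin_loss z \<le> fin_loss w"
      using monoD[OF mono, of z w] by (simp add: l_eq_fin_loss)
  qed
  then have "fin_loss \<in> borel_measurable (restrict_space borel edom)"
    by (rule borel_measurable_mono_on_fnc)
  then have "(\<lambda>z. indicator edom z *\<^sub>R fin_loss z) \<in> borel_measurable borel"
    by (subst borel_measurable_restrict_space_iff[symmetric]) auto
  moreover have "(\<lambda>z. indicator edom z *\<^sub>R fin_loss z) = fin_loss"
    by (auto simp: fun_eq_iff fin_loss_def edom_def indicator_def)
  ultimately show ?thesis by simp
qed

text \<open>Subtracting the supporting line leaves a function with a local minimum at \<open>z\<close>.\<close>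

lemma score_eq_deriv:
  assumes z: "z \<in> interior edom" and "fin_loss field_differentiable at z"
  shows "score z = deriv fin_loss z"
proof -
  obtain e where "e > 0" and e: "ball z e \<subseteq> edom"
    using z by (auto simp: mem_interior)
  have "(fin_loss has_real_derivative deriv fin_loss z) (at z)"
    using assms(2) by (simp add: DERIV_deriv_iff_field_differentiable)
  then have "((\<lambda>y. fin_loss y - score z * (y - z)) has_real_derivative deriv fin_loss z - score z) (at z)"
    by (auto intro!: derivative_eq_intros)
  moreover have "\<forall>y. \<bar>z - y\<bar> < e \<longrightarrow> fin_loss z - score z * (z - z) \<le> fin_loss y - score z * (y - z)"
  proof (intro allI impI)
    fix y assume "\<bar>z - y\<bar> < e"
    then have "y \<in> edom" using e by (auto simp: dist_real_def)
    then show "fin_loss z - score z * (z - z) \<le> fin_loss y - score z * (y - z)"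
      using score_subgradient_edom[OF z, of y] by simp
  qed
  ultimately have "deriv fin_loss z - score z = 0"
    using \<open>e > 0\<close> DERIV_local_min by blast
  then show ?thesis by simp
qed

lemma continuously_differentiable_at_score:
  assumes "continuously_differentiable_at (\<lambda>s. l (x - s)) t"
  shows "x - t \<in> interior edom" "score (x - t) = ext_deriv l (x - t)"
    "isCont (\<lambda>s. score (x - s)) t"
proof -
  have "\<forall>\<^sub>F y in nhds t. \<bar>l (x - y)\<bar> \<noteq> \<infinity> \<and>
      (\<lambda>z. real_of_ereal (l (x - z))) field_differentiable at y"
    using assms by (simp add: continuously_differentiable_at_def)
  then have "\<forall>\<^sub>F y in nhds t. x - y \<in> edom \<and> fin_loss field_differentiable at (x - y)"
  proof (rule eventually_mono)
    fix y assume y: "\<bar>l (x - y)\<bar> \<noteq> \<infinity> \<and> (\<lambda>z. real_of_ereal (l (x - z))) field_differentiable at y"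
    have "(\<lambda>w. x - w) field_differentiable at (x - y)"
      by (intro derivative_intros)
    moreover have "(\<lambda>z. fin_loss (x - z)) field_differentiable at (x - (x - y))"
      using y by (simp add: fin_loss_def)
    ultimately have "((\<lambda>z. fin_loss (x - z)) \<circ> (\<lambda>w. x - w)) field_differentiable at (x - y)"
      by (rule field_differentiable_compose)
    then show "x - y \<in> edom \<and> fin_loss field_differentiable at (x - y)"
      using y by (auto simp: edom_def comp_def)
  qed
  then obtain e where "e > 0"
    and e: "\<And>y. dist y t < e \<Longrightarrow> x - y \<in> edom \<and> fin_loss field_differentiable at (x - y)"
    by (auto simp: eventually_nhds_metric)
  have int: "x - y \<in> interior edom" if "dist y t < e" for y
    unfolding mem_interior
  proof (intro exI conjI subsetI)
    show "e - dist y t > 0" using that by simp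
    fix w assume "w \<in> ball (x - y) (e - dist y t)"
    then have "dist (x - w) t < e" by (auto simp: dist_real_def)
    from e[OF this] show "w \<in> edom" by simp
  qed
  have eq: "score (x - y) = - ext_deriv (\<lambda>s. l (x - s)) y" "score (x - y) = ext_deriv l (x - y)"
    if "dist y t < e" for y
  proof -
    have s: "score (x - y) = deriv fin_loss (x - y)"
      using int[OF that] e[OF that] by (intro score_eq_deriv) auto
    then show "score (x - y) = ext_deriv l (x - y)"
      by (simp add: ext_deriv_def fin_loss_def[abs_def])
    have "(fin_loss has_real_derivative score (x - y)) (at (x - y))"
      using e[OF that] by (simp add: s DERIV_deriv_iff_field_differentiable)
    then have "((\<lambda>s. fin_loss (x - s)) has_real_derivative score (x - y) * (-1)) (at y)"
      by (rule DERIV_chain2) (auto intro!: derivative_eq_intros)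
    then show "score (x - y) = - ext_deriv (\<lambda>s. l (x - s)) y"
      using DERIV_imp_deriv by (fastforce simp: ext_deriv_def fin_loss_def)
  qed
  show "x - t \<in> interior edom" "score (x - t) = ext_deriv l (x - t)"
    using int[of t] eq(2)[of t] \<open>e > 0\<close> by auto
  have "\<forall>\<^sub>F y in nhds t. - ext_deriv (\<lambda>s. l (x - s)) y = score (x - y)"
    unfolding eventually_nhds_metric using \<open>e > 0\<close> eq(1) by (intro exI[of _ e]) auto
  moreover have "isCont (\<lambda>y. - ext_deriv (\<lambda>s. l (x - s)) y) t"
    using assms by (intro continuous_intros) (simp add: continuously_differentiable_at_def)
  ultimately show "isCont (\<lambda>s. score (x - s)) t"
    by (simp only: isCont_cong[of _ "\<lambda>s. score (x - s)" t])
qed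

text \<open>Test the subgradient inequality at points of \<open>T\<close> on both sides of \<open>t\<close>.\<close>

lemma abs_score_le_lipschitz:
  assumes t: "t \<in> interior T" and z: "x - t \<in> interior edom"
    and lip: "\<forall>t1\<in>T. \<forall>t2\<in>T. \<bar>l (x - t1) - l (x - t2)\<bar> \<le> ereal (k * \<bar>t1 - t2\<bar>)"
  shows "\<bar>score (x - t)\<bar> \<le> k"
proof -
  obtain e where "e > 0" and e: "ball t e \<subseteq> T"
    using t by (auto simp: mem_interior)
  have tT: "t \<in> T" using t interior_subset by blast
  have lz: "l (x - t) = ereal (fin_loss (x - t))"
    using z interior_subset by (intro l_eq_fin_loss) auto
  have key: "score (x - t) * (t - s) \<le> k * \<bar>s - t\<bar>" if "s \<in> T" for s
  proof -
    have "ereal (fin_loss (x - t) + score (x - t) * (t - s)) \<le> l (x - s)"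
      using score_subgradient[OF z, of "x - s"] by simp
    moreover have "\<bar>l (x - s) - l (x - t)\<bar> \<le> ereal (k * \<bar>s - t\<bar>)"
      using lip that tT by blast
    ultimately show ?thesis
      unfolding lz by (cases "l (x - s)") auto
  qed
  have "t + e / 2 \<in> T" "t - e / 2 \<in> T"
    using e \<open>e > 0\<close> by (auto simp: dist_real_def intro!: subsetD[OF e])
  from this[THEN key] have "e * score (x - t) \<le> e * k" "e * (- score (x - t)) \<le> e * k"
    using \<open>e > 0\<close> by (auto simp: algebra_simps)
  then show ?thesis
    using \<open>e > 0\<close> by (simp only: mult_le_cancel_left_pos abs_le_iff)
qed

text \<open>The number \<open>1 - score (x i - s)\<close>, averaged over the sample, is a subgradient of the sample
  objective at \<open>s\<close>. It therefore points away from every minimizer, which locates the minimizer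
  relative to \<open>s\<close> by a sum of independent terms.\<close>

lemma saa_minimizer_score:
  assumes z: "\<And>i. i \<in> {1..n} \<Longrightarrow> x i - s \<in> interior edom" and "n \<ge> 1" and "s \<in> T"
    and opt: "is_arg_min (saa_objective l x n) (\<lambda>t. t \<in> T) t"
  shows "(t - s) * (\<Sum>i = 1..n. 1 - score (x i - s)) \<le> 0"
proof -
  define b where "b i = fin_loss (x i - s) + score (x i - s) * (s - t)" for i
  have "saa_objective l x n t \<le> saa_objective l x n s"
    using opt \<open>s \<in> T\<close> by (auto simp: is_arg_min_def not_less)
  moreover have "saa_objective l x n s = ereal (s + (1 / real n) * (\<Sum>i = 1..n. fin_loss (x i - s)))"
  proof -
    have "(\<Sum>i = 1..n. l (x i - s)) = (\<Sum>i = 1..n. ereal (fin_loss (x i - s)))"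
      using z interior_subset by (intro sum.cong l_eq_fin_loss) auto
    then show ?thesis by (simp add: saa_objective_def)
  qed
  moreover have "ereal (t + (1 / real n) * (\<Sum>i = 1..n. b i)) \<le> saa_objective l x n t"
  proof -
    have "(\<Sum>i = 1..n. ereal (b i)) \<le> (\<Sum>i = 1..n. l (x i - t))"
    proof (rule sum_mono)
      fix i assume "i \<in> {1..n}"
      from score_subgradient[OF z[OF this], of "x i - t"] show "ereal (b i) \<le> l (x i - t)"
        by (simp add: b_def)
    qed
    then have "ereal (1 / real n) * ereal (\<Sum>i = 1..n. b i)
        \<le> ereal (1 / real n) * (\<Sum>i = 1..n. l (x i - t))"
      by (intro ereal_mult_left_mono) auto
    then show ?thesis
      unfolding saa_objective_def by (metis add_left_mono plus_ereal.simps(1) times_ereal.simps(1))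
  qed
  ultimately have "t + (1 / real n) * (\<Sum>i = 1..n. b i)
      \<le> s + (1 / real n) * (\<Sum>i = 1..n. fin_loss (x i - s))"
    by (metis ereal_less_eq(3) order_trans)
  then have "real n * (t + (1 / real n) * (\<Sum>i = 1..n. b i))
      \<le> real n * (s + (1 / real n) * (\<Sum>i = 1..n. fin_loss (x i - s)))"
    by (rule mult_left_mono) simp
  then have "real n * t + (\<Sum>i = 1..n. b i) \<le> real n * s + (\<Sum>i = 1..n. fin_loss (x i - s))"
    using \<open>n \<ge> 1\<close> by (simp add: distrib_left)
  moreover have "(\<Sum>i = 1..n. b i)
      = (\<Sum>i = 1..n. fin_loss (x i - s)) + (s - t) * (\<Sum>i = 1..n. score (x i - s))"
    by (simp add: b_def sum.distrib sum_distrib_left mult.commute)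
  ultimately show ?thesis
    by (simp add: sum_subtractf algebra_simps)
qed

end

text \<open>Reflecting the hypograph of \<open>u\<close> in both axes turns its convexity into convexity of \<open>l\<close> on the
  effective domain.\<close>

lemma extended_convex_loss_of_utility:
  assumes u: "proper_closed_concave u" and mono: "mono u" and l: "\<And>z. l z = - u (- z)"
  shows "extended_convex_loss l"
proof
  show "l z \<noteq> -\<infinity>" for z
    using u by (simp add: l proper_closed_concave_def ereal_uminus_eq_reorder)
  show "mono l"
    using monoD[OF mono] by (intro monoI) (simp add: l)
  have fin: "u (- z) = ereal (- real_of_ereal (l z))" if "l z \<noteq> \<infinity>" for z
    using that u by (cases "u (- z)") (auto simp: l proper_closed_concave_def)
  have hyp: "convex (hypograph u)" using u by (simp add: proper_closed_concave_def)
  have key: "ereal (- (a * real_of_ereal (l x) + b * real_of_ereal (l y))) \<le> u (- (a * x + b * y))"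
    if "l x \<noteq> \<infinity>" "l y \<noteq> \<infinity>" "a \<ge> 0" "b \<ge> 0" "a + b = 1" for a b x y
  proof -
    have "(- x, - real_of_ereal (l x)) \<in> hypograph u" "(- y, - real_of_ereal (l y)) \<in> hypograph u"
      using that fin by (auto simp: hypograph_def)
    from convexD[OF hyp this that(3-5)] show ?thesis
      by (simp add: hypograph_def algebra_simps)
  qed
  have dom: "l (a * x + b * y) \<noteq> \<infinity>"
    if "l x \<noteq> \<infinity>" "l y \<noteq> \<infinity>" "a \<ge> 0" "b \<ge> 0" "a + b = 1" for a b x y
    using key[OF that] by (auto simp: l ereal_uminus_eq_reorder)
  show "convex_on {z. l z \<noteq> \<infinity>} (\<lambda>z. real_of_ereal (l z))"
    unfolding convex_on_def
  proof (intro conjI ballI allI impI)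
    show "convex {z. l z \<noteq> \<infinity>}"
      using dom by (auto simp: convex_def)
    fix x y a b :: real
    assume "x \<in> {z. l z \<noteq> \<infinity>}" "y \<in> {z. l z \<noteq> \<infinity>}" "0 \<le> a" "0 \<le> b" "a + b = 1"
    then have *: "l x \<noteq> \<infinity>" "l y \<noteq> \<infinity>" "a \<ge> 0" "b \<ge> 0" "a + b = 1" by auto
    show "real_of_ereal (l (a *\<^sub>R x + b *\<^sub>R y)) \<le> a * real_of_ereal (l x) + b * real_of_ereal (l y)"
      using key[OF *] fin[OF dom[OF *]] by simp
  qed
qed

section \<open>Weak convergence and drifting central limit theorems\<close>

lemma cmod_iexp_diff_le: "cmod (iexp a - iexp b) \<le> \<bar>a - b\<bar>"
proof -
  have "iexp a - iexp b = iexp b * (iexp (a - b) - 1)"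
    by (simp add: algebra_simps flip: exp_add)
  then have "cmod (iexp a - iexp b) = cmod (iexp (a - b) - 1)"
    by (simp only: norm_mult norm_exp_i_times mult_1_left)
  also have "\<dots> \<le> \<bar>a - b\<bar>"
    using iexp_approx1[of "a - b" 0] by simp
  finally show ?thesis .
qed

lemma char_distr:
  assumes [measurable]: "W \<in> borel_measurable M"
  shows "char (distr M borel W) t = (CLINT \<omega>|M. iexp (t * W \<omega>))"
  unfolding char_def by (rule integral_distr) (auto simp del: of_real_mult)

lemma (in prob_space) cmod_char_diff_le:
  assumes [measurable]: "W \<in> borel_measurable M" "V \<in> borel_measurable M"
    and int: "integrable M (\<lambda>\<omega>. W \<omega> - V \<omega>)"
  shows "cmod (char (distr M borel W) t - char (distr M borel V) t)
    \<le> \<bar>t\<bar> * expectation (\<lambda>\<omega>. \<bar>W \<omega> - V \<omega>\<bar>)"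
proof -
  have iexp_int: "integrable M (\<lambda>\<omega>. iexp (t * Y \<omega>))" if [measurable]: "Y \<in> borel_measurable M" for Y
    by (rule integrable_const_bound[where B=1]) (auto simp del: of_real_mult)
  have "char (distr M borel W) t - char (distr M borel V) t
      = (CLINT \<omega>|M. iexp (t * W \<omega>) - iexp (t * V \<omega>))"
    by (simp only: char_distr assms Bochner_Integration.integral_diff[OF iexp_int iexp_int])
  also have "cmod \<dots> \<le> (\<integral>\<omega>. cmod (iexp (t * W \<omega>) - iexp (t * V \<omega>)) \<partial>M)"
    by (rule integral_norm_bound)
  also have "\<dots> \<le> (\<integral>\<omega>. \<bar>t\<bar> * \<bar>W \<omega> - V \<omega>\<bar> \<partial>M)"
  proof (rule integral_mono)
    show "integrable M (\<lambda>\<omega>. cmod (iexp (t * W \<omega>) - iexp (t * V \<omega>)))"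
      by (intro integrable_norm Bochner_Integration.integrable_diff iexp_int assms)
    show "integrable M (\<lambda>\<omega>. \<bar>t\<bar> * \<bar>W \<omega> - V \<omega>\<bar>)"
      using int by auto
    show "cmod (iexp (t * W \<omega>) - iexp (t * V \<omega>)) \<le> \<bar>t\<bar> * \<bar>W \<omega> - V \<omega>\<bar>" for \<omega>
      using cmod_iexp_diff_le[of "t * W \<omega>" "t * V \<omega>"]
      by (simp add: abs_mult flip: right_diff_distrib)
  qed
  finally show ?thesis by simp
qed

text \<open>Slutsky's lemma in its \<open>L\<^sup>1\<close> form. Characteristic functions make it short: they are
  Lipschitz in the random variable with respect to the \<open>L\<^sup>1\<close> distance.\<close>

lemma (in prob_space) weak_conv_m_perturb:
  assumes W [measurable]: "\<And>n. W n \<in> borel_measurable M"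
    and V [measurable]: "\<And>n. V n \<in> borel_measurable M"
    and int: "\<forall>\<^sub>F n in sequentially. integrable M (\<lambda>\<omega>. W n \<omega> - V n \<omega>)"
    and lim: "(\<lambda>n. expectation (\<lambda>\<omega>. \<bar>W n \<omega> - V n \<omega>\<bar>)) \<longlonglongrightarrow> 0"
    and N: "real_distribution N"
    and conv: "weak_conv_m (\<lambda>n. distr M borel (V n)) N"
  shows "weak_conv_m (\<lambda>n. distr M borel (W n)) N"
proof (rule levy_continuity)
  fix t
  have "(\<lambda>n. char (distr M borel (W n)) t - char (distr M borel (V n)) t) \<longlonglongrightarrow> 0"
  proof (rule Lim_null_comparison)
    show "\<forall>\<^sub>F n in sequentially. cmod (char (distr M borel (W n)) t - char (distr M borel (V n)) t)
      \<le> \<bar>t\<bar> * expectation (\<lambda>\<omega>. \<bar>W n \<omega> - V n \<omega>\<bar>)"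
      using int by eventually_elim (rule cmod_char_diff_le[OF W V])
    show "(\<lambda>n. \<bar>t\<bar> * expectation (\<lambda>\<omega>. \<bar>W n \<omega> - V n \<omega>\<bar>)) \<longlonglongrightarrow> 0"
      using tendsto_mult_right_zero[OF lim] by simp
  qed
  moreover have "(\<lambda>n. char (distr M borel (V n)) t) \<longlonglongrightarrow> char N t"
    by (rule levy_continuity1) (auto simp: N conv)
  ultimately show "(\<lambda>n. char (distr M borel (W n)) t) \<longlonglongrightarrow> char N t"
    using tendsto_add by fastforce
qed (auto simp: N)

lemma (in prob_space) weak_conv_m_scale:
  assumes V [measurable]: "\<And>n. V n \<in> borel_measurable M"
    and N: "real_distribution N"
    and conv: "weak_conv_m (\<lambda>n. distr M borel (V n)) N"
  shows "weak_conv_m (\<lambda>n. distr M borel (\<lambda>\<omega>. c * V n \<omega>)) (distr N borel (\<lambda>x. c * x))"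
proof (rule levy_continuity)
  interpret N: real_distribution N by (rule N)
  show "real_distribution (distr N borel (\<lambda>x. c * x))"
    by (intro N.real_distribution_distr) simp
  fix t
  have "char (distr M borel (\<lambda>\<omega>. c * V n \<omega>)) t = char (distr M borel (V n)) (t * c)" for n
    by (simp add: char_distr mult.assoc)
  moreover have "char (distr N borel (\<lambda>x. c * x)) t = char N (t * c)"
    by (subst char_distr) (simp_all add: char_def mult.assoc)
  moreover have "(\<lambda>n. char (distr M borel (V n)) (t * c)) \<longlonglongrightarrow> char N (t * c)"
    by (rule levy_continuity1) (auto simp: N conv)
  ultimately show "(\<lambda>n. char (distr M borel (\<lambda>\<omega>. c * V n \<omega>)) t)
    \<longlonglongrightarrow> char (distr N borel (\<lambda>x. c * x)) t"
    by simp
qed auto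

lemma real_distribution_normal_law: "real_distribution (normal_law m v)"
proof -
  interpret real_distribution std_normal_distribution by (rule real_dist_normal_dist)
  show ?thesis unfolding normal_law_def by (rule real_distribution_distr) simp
qed

lemma normal_law_0_0: "normal_law 0 0 = return borel 0"
proof -
  interpret real_distribution std_normal_distribution by (rule real_dist_normal_dist)
  show ?thesis unfolding normal_law_def by (simp add: distr_const)
qed

lemma normal_law_divide:
  assumes "a > 0"
  shows "distr (normal_law 0 v) borel (\<lambda>y. y / a) = normal_law 0 (v / a\<^sup>2)"
  unfolding normal_law_def using assms
  by (subst distr_distr) (auto simp: comp_def real_sqrt_divide)

text \<open>The central limit theorem in a normalization that also makes sense for variance \<open>0\<close>, where
  the summands vanish almost surely and the limit is the point mass at \<open>0\<close>.\<close>

lemma (in prob_space) clt_normal_law: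
  assumes indep: "indep_vars (\<lambda>_. borel) Y UNIV"
    and mean: "\<And>i. expectation (Y i) = 0"
    and sq: "\<And>i. integrable M (\<lambda>\<omega>. (Y i \<omega>)\<^sup>2)"
    and var: "\<And>i. expectation (\<lambda>\<omega>. (Y i \<omega>)\<^sup>2) = v"
    and distr: "\<And>i. distr M borel (Y i) = \<mu>"
  shows "weak_conv_m (\<lambda>n. distr M borel (\<lambda>\<omega>. (\<Sum>i<n. Y i \<omega>) / sqrt (real n))) (normal_law 0 v)"
proof -
  have Y [measurable]: "Y i \<in> borel_measurable M" for i
    using indep by (simp add: indep_vars_def2)
  have "v \<ge> 0"
    using var[of 0, symmetric] by simp
  then consider "v > 0" | "v = 0" by linarith
  then show ?thesis
  proof cases
    case 1
    have "weak_conv_m (\<lambda>n. distr M borel (\<lambda>\<omega>. (\<Sum>i<n. Y i \<omega>) / sqrt (n * (sqrt v)\<^sup>2)))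
        std_normal_distribution"
      by (rule central_limit_theorem_zero_mean[OF indep mean _ sq _ distr])
        (use 1 in \<open>simp_all add: mean var\<close>)
    from weak_conv_m_scale[OF _ real_dist_normal_dist this, of "sqrt v"]
    show ?thesis using 1 by (simp add: normal_law_def real_sqrt_mult)
  next
    case 2
    have "AE \<omega> in M. Y i \<omega> = 0" for i
      using var[of i] integral_nonneg_eq_0_iff_AE[OF sq[of i]] by (simp add: 2)
    then have all0: "AE \<omega> in M. \<forall>i. Y i \<omega> = 0"
      by (simp add: AE_all_countable)
    have "weak_conv_m (\<lambda>n::nat. distr M borel (\<lambda>\<omega>. 0)) (normal_law 0 0)"
      by (simp add: distr_const normal_law_0_0 weak_conv_m_def weak_conv_def)
    then show ?thesis
      unfolding 2
    proof (rule weak_conv_m_perturb[rotated 5])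
      have z: "AE \<omega> in M. \<bar>(\<Sum>i<n. Y i \<omega>) / sqrt (real n) - 0\<bar> = 0" for n
        using all0 by eventually_elim simp
      show "\<forall>\<^sub>F n in sequentially. integrable M (\<lambda>\<omega>. (\<Sum>i<n. Y i \<omega>) / sqrt (real n) - 0)"
      proof (intro always_eventually allI)
        fix n
        have "AE \<omega> in M. 0 = (\<Sum>i<n. Y i \<omega>) / sqrt (real n) - 0"
          using all0 by eventually_elim simp
        then show "integrable M (\<lambda>\<omega>. (\<Sum>i<n. Y i \<omega>) / sqrt (real n) - 0)"
          by (rule integrable_cong_AE_imp[of M "\<lambda>_. 0", rotated 2]) simp_all
      qed
      have "expectation (\<lambda>\<omega>. \<bar>(\<Sum>i<n. Y i \<omega>) / sqrt (real n) - 0\<bar>) = 0" for n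
        using integral_cong_AE[OF _ _ z[of n]] by simp
      then show "(\<lambda>n. expectation (\<lambda>\<omega>. \<bar>(\<Sum>i<n. Y i \<omega>) / sqrt (real n) - 0\<bar>)) \<longlonglongrightarrow> 0"
        by (simp only: tendsto_const)
    qed (auto simp: real_distribution_normal_law)
  qed
qed

lemma (in prob_space) second_moment_sum_indep:
  fixes Y :: "nat \<Rightarrow> 'a \<Rightarrow> real"
  assumes indep: "indep_vars (\<lambda>_. borel) Y UNIV"
    and mean: "\<And>i. expectation (Y i) = 0"
    and sq: "\<And>i. integrable M (\<lambda>\<omega>. (Y i \<omega>)\<^sup>2)"
  shows "integrable M (\<lambda>\<omega>. (\<Sum>i<n. Y i \<omega>)\<^sup>2) \<and>
    expectation (\<lambda>\<omega>. (\<Sum>i<n. Y i \<omega>)\<^sup>2) = (\<Sum>i<n. expectation (\<lambda>\<omega>. (Y i \<omega>)\<^sup>2))"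
proof (induction n)
  case (Suc n)
  have Y [measurable]: "Y i \<in> borel_measurable M" for i
    using indep by (simp add: indep_vars_def2)
  have int: "integrable M (Y i)" for i
    by (rule square_integrable_imp_integrable) (auto simp: sq)
  have ind: "indep_var borel (Y n) borel (\<lambda>\<omega>. \<Sum>i<n. Y i \<omega>)"
    by (rule indep_vars_sum) (auto intro: indep_vars_subset[OF indep])
  have int': "integrable M (\<lambda>\<omega>. \<Sum>i<n. Y i \<omega>)"
    using int by auto
  have cross: "integrable M (\<lambda>\<omega>. Y n \<omega> * (\<Sum>i<n. Y i \<omega>))"
    "expectation (\<lambda>\<omega>. Y n \<omega> * (\<Sum>i<n. Y i \<omega>)) = 0"
    using indep_var_integrable[OF ind int int'] indep_var_lebesgue_integral[OF ind int int'] mean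
    by auto
  have eq: "(\<Sum>i<Suc n. Y i \<omega>)\<^sup>2
      = (\<Sum>i<n. Y i \<omega>)\<^sup>2 + 2 * (Y n \<omega> * (\<Sum>i<n. Y i \<omega>)) + (Y n \<omega>)\<^sup>2" for \<omega>
    by (simp add: power2_eq_square algebra_simps)
  show ?case
    unfolding eq using Suc cross sq by (simp del: sum.lessThan_Suc add: sum.lessThan_Suc[of _ n])
qed simp

lemma (in prob_space) expectation_abs_le_sqrt:
  assumes [measurable]: "Y \<in> borel_measurable M" and sq: "integrable M (\<lambda>\<omega>. (Y \<omega>)\<^sup>2)"
  shows "expectation (\<lambda>\<omega>. \<bar>Y \<omega>\<bar>) \<le> sqrt (expectation (\<lambda>\<omega>. (Y \<omega>)\<^sup>2))"
proof (rule real_le_rsqrt)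
  have "integrable M Y"
    by (rule square_integrable_imp_integrable) (auto simp: sq)
  then have "variance (\<lambda>\<omega>. \<bar>Y \<omega>\<bar>) = expectation (\<lambda>\<omega>. (Y \<omega>)\<^sup>2) - (expectation (\<lambda>\<omega>. \<bar>Y \<omega>\<bar>))\<^sup>2"
    by (subst variance_eq) (auto simp: sq)
  then show "(expectation (\<lambda>\<omega>. \<bar>Y \<omega>\<bar>))\<^sup>2 \<le> expectation (\<lambda>\<omega>. (Y \<omega>)\<^sup>2)"
    using variance_positive[of "\<lambda>\<omega>. \<bar>Y \<omega>\<bar>"] by linarith
qed

text \<open>The summands form a triangular array, which is compared with a single sequence: the array
  differs from the sequence with the fixed function \<open>h\<close> by a normalized sum of independent centred
  terms, whose second moment is at most that of \<open>hn n (\<xi>) - h (\<xi>)\<close>. This tends to \<open>0\<close>, so the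
  ordinary central limit theorem for \<open>h\<close> carries over.\<close>

lemma (in prob_space) clt_drifting_functions:
  fixes X :: "nat \<Rightarrow> 'a \<Rightarrow> real" and \<xi> :: "'a \<Rightarrow> real"
  assumes indep: "indep_vars (\<lambda>_. borel) X UNIV"
    and \<xi> [measurable]: "\<xi> \<in> borel_measurable M"
    and distr: "\<And>i. distr M borel (X i) = distr M borel \<xi>"
    and h [measurable]: "h \<in> borel_measurable borel"
    and hn [measurable]: "\<And>n. hn n \<in> borel_measurable borel"
    and sq: "integrable M (\<lambda>\<omega>. (h (\<xi> \<omega>))\<^sup>2)"
    and sqn: "\<forall>\<^sub>F n in sequentially. integrable M (\<lambda>\<omega>. (hn n (\<xi> \<omega>))\<^sup>2)"
    and lim: "(\<lambda>n. expectation (\<lambda>\<omega>. (hn n (\<xi> \<omega>) - h (\<xi> \<omega>))\<^sup>2)) \<longlonglongrightarrow> 0"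
  shows "weak_conv_m
    (\<lambda>n. distr M borel
      (\<lambda>\<omega>. (\<Sum>i<n. hn n (X i \<omega>) - expectation (\<lambda>\<omega>. hn n (\<xi> \<omega>))) / sqrt (real n)))
    (normal_law 0 (variance (\<lambda>\<omega>. h (\<xi> \<omega>))))"
    (is "weak_conv_m (\<lambda>n. distr M borel (?W n)) _")
proof -
  have X [measurable]: "X i \<in> borel_measurable M" for i
    using indep by (simp add: indep_vars_def2)
  have same: "integrable M (\<lambda>\<omega>. f (X i \<omega>)) \<longleftrightarrow> integrable M (\<lambda>\<omega>. f (\<xi> \<omega>))"
    "expectation (\<lambda>\<omega>. f (X i \<omega>)) = expectation (\<lambda>\<omega>. f (\<xi> \<omega>))"
    if [measurable]: "f \<in> borel_measurable borel" for f :: "real \<Rightarrow> real" and i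
    using integrable_distr_eq[of "X i" M borel f] integrable_distr_eq[of \<xi> M borel f]
      integral_distr[of "X i" M borel f] integral_distr[of \<xi> M borel f] distr[of i] by auto
  define m where "m = expectation (\<lambda>\<omega>. h (\<xi> \<omega>))"
  define mn where "mn n = expectation (\<lambda>\<omega>. hn n (\<xi> \<omega>))" for n
  have hint: "integrable M (\<lambda>\<omega>. h (\<xi> \<omega>))"
    by (rule square_integrable_imp_integrable) (auto simp: sq)
  define V where "V n \<omega> = (\<Sum>i<n. h (X i \<omega>) - m) / sqrt (real n)" for n \<omega>
  have conv: "weak_conv_m (\<lambda>n. distr M borel (V n)) (normal_law 0 (variance (\<lambda>\<omega>. h (\<xi> \<omega>))))"
    unfolding V_def
  proof (rule clt_normal_law)
    show "indep_vars (\<lambda>_. borel) (\<lambda>i \<omega>. h (X i \<omega>) - m) UNIV"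
      by (rule indep_vars_compose2[OF indep]) simp
    show "expectation (\<lambda>\<omega>. h (X i \<omega>) - m) = 0" for i
      using same(2)[of "\<lambda>x. h x - m" i] hint by (simp add: m_def prob_space)
    show "integrable M (\<lambda>\<omega>. (h (X i \<omega>) - m)\<^sup>2)" for i
      using hint sq by (subst same(1)[of "\<lambda>x. (h x - m)\<^sup>2"]) (auto simp: power2_diff)
    show "expectation (\<lambda>\<omega>. (h (X i \<omega>) - m)\<^sup>2) = variance (\<lambda>\<omega>. h (\<xi> \<omega>))" for i
      by (subst same(2)[of "\<lambda>x. (h x - m)\<^sup>2"]) (auto simp: m_def)
    show "distr M borel (\<lambda>\<omega>. h (X i \<omega>) - m) = distr (distr M borel \<xi>) borel (\<lambda>x. h x - m)" for i
      using distr[of i, symmetric] by (simp add: distr_distr comp_def)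
  qed
  define B where "B n = expectation (\<lambda>\<omega>. (hn n (\<xi> \<omega>) - h (\<xi> \<omega>))\<^sup>2)" for n
  have L2: "integrable M (\<lambda>\<omega>. ?W n \<omega> - V n \<omega>) \<and>
      expectation (\<lambda>\<omega>. \<bar>?W n \<omega> - V n \<omega>\<bar>) \<le> sqrt (B n)"
    if sqn: "integrable M (\<lambda>\<omega>. (hn n (\<xi> \<omega>))\<^sup>2)" and "n \<ge> 1" for n
  proof -
    \<comment> \<open>Centring both functions makes the summands orthogonal and can only reduce the second moment.\<close>
    define d where "d x = (hn n x - mn n) - (h x - m)" for x
    have [measurable]: "d \<in> borel_measurable borel" by (simp add: d_def[abs_def])
    have hnint: "integrable M (\<lambda>\<omega>. hn n (\<xi> \<omega>))"
      by (rule square_integrable_imp_integrable) (auto simp: sqn)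
    have diffsq: "integrable M (\<lambda>\<omega>. (hn n (\<xi> \<omega>) - h (\<xi> \<omega>))\<^sup>2)"
    proof (rule Bochner_Integration.integrable_bound)
      show "integrable M (\<lambda>\<omega>. 2 * (hn n (\<xi> \<omega>))\<^sup>2 + 2 * (h (\<xi> \<omega>))\<^sup>2)"
        using sq sqn by simp
      have "(a - b)\<^sup>2 \<le> 2 * a\<^sup>2 + 2 * b\<^sup>2" for a b :: real
        using zero_le_power2[of "a + b"] by (simp add: power2_diff power2_sum)
      then show "AE \<omega> in M. norm ((hn n (\<xi> \<omega>) - h (\<xi> \<omega>))\<^sup>2)
          \<le> norm (2 * (hn n (\<xi> \<omega>))\<^sup>2 + 2 * (h (\<xi> \<omega>))\<^sup>2)"
        by (intro AE_I2) (simp add: abs_of_nonneg)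
    qed simp
    have dsq: "integrable M (\<lambda>\<omega>. (d (\<xi> \<omega>))\<^sup>2)"
    proof -
      have "d x = (hn n x - h x) - (mn n - m)" for x by (simp add: d_def)
      then show ?thesis using diffsq hnint hint
        by (simp add: power2_diff[of "_ - _" "mn n - m"])
    qed
    have dmean: "expectation (\<lambda>\<omega>. d (\<xi> \<omega>)) = 0"
      using hint hnint by (simp add: d_def m_def mn_def prob_space)
    have dvar: "expectation (\<lambda>\<omega>. (d (\<xi> \<omega>))\<^sup>2) \<le> B n"
    proof -
      have "expectation (\<lambda>\<omega>. (d (\<xi> \<omega>))\<^sup>2) = variance (\<lambda>\<omega>. hn n (\<xi> \<omega>) - h (\<xi> \<omega>))"
        using hint hnint by (intro Bochner_Integration.integral_cong) (auto simp: d_def m_def mn_def algebra_simps)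
      also have "\<dots> = B n - (expectation (\<lambda>\<omega>. hn n (\<xi> \<omega>) - h (\<xi> \<omega>)))\<^sup>2"
        unfolding B_def using hint hnint diffsq by (intro variance_eq) auto
      finally show ?thesis by simp
    qed
    define R where "R \<omega> = (\<Sum>i<n. d (X i \<omega>)) / sqrt (real n)" for \<omega>
    have [measurable]: "R \<in> borel_measurable M" by (simp add: R_def[abs_def])
    have diff: "?W n \<omega> - V n \<omega> = R \<omega>" for \<omega>
      by (simp add: V_def R_def d_def mn_def sum_subtractf diff_divide_distrib)
    have "indep_vars (\<lambda>_. borel) (\<lambda>i \<omega>. d (X i \<omega>)) UNIV"
      by (rule indep_vars_compose2[OF indep]) simp
    from second_moment_sum_indep[OF this, of n]
    have S: "integrable M (\<lambda>\<omega>. (\<Sum>i<n. d (X i \<omega>))\<^sup>2)"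
      "expectation (\<lambda>\<omega>. (\<Sum>i<n. d (X i \<omega>))\<^sup>2) = real n * expectation (\<lambda>\<omega>. (d (\<xi> \<omega>))\<^sup>2)"
      using dmean dsq same[of d] same[of "\<lambda>x. (d x)\<^sup>2"] by auto
    have Rsq: "integrable M (\<lambda>\<omega>. (R \<omega>)\<^sup>2)" "expectation (\<lambda>\<omega>. (R \<omega>)\<^sup>2) \<le> B n"
      using S dvar \<open>n \<ge> 1\<close> by (auto simp: R_def power_divide)
    have "integrable M R"
      by (rule square_integrable_imp_integrable) (auto simp: Rsq)
    moreover have "expectation (\<lambda>\<omega>. \<bar>R \<omega>\<bar>) \<le> sqrt (B n)"
      using expectation_abs_le_sqrt[OF _ Rsq(1)] Rsq(2) by (auto intro: order_trans)
    ultimately show ?thesis unfolding diff by auto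
  qed
  have ev: "\<forall>\<^sub>F n in sequentially. integrable M (\<lambda>\<omega>. ?W n \<omega> - V n \<omega>) \<and>
      expectation (\<lambda>\<omega>. \<bar>?W n \<omega> - V n \<omega>\<bar>) \<le> sqrt (B n)"
    using sqn eventually_ge_at_top[of 1] by eventually_elim (rule L2)
  show ?thesis
  proof (rule weak_conv_m_perturb[OF _ _ _ _ real_distribution_normal_law conv])
    show "\<forall>\<^sub>F n in sequentially. integrable M (\<lambda>\<omega>. ?W n \<omega> - V n \<omega>)"
      using ev by eventually_elim simp
    have "(\<lambda>n. sqrt (B n)) \<longlonglongrightarrow> 0"
      using tendsto_real_sqrt[OF lim] by (simp add: B_def)
    then show "(\<lambda>n. expectation (\<lambda>\<omega>. \<bar>?W n \<omega> - V n \<omega>\<bar>)) \<longlonglongrightarrow> 0"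
      by (rule Lim_null_comparison[rotated]) (use ev in eventually_elim, simp)
  qed (auto simp: V_def[abs_def])
qed

lemma (in real_distribution) isCont_cdf_dense:
  assumes "a < b"
  obtains y where "a < y" "y < b" "isCont (cdf M) y"
proof -
  have "uncountable {a<..<b}" using assms by (simp add: uncountable_open_interval)
  then have "\<not> {a<..<b} \<subseteq> {x. measure M {x} > 0}"
    using countable_atoms countable_subset by blast
  then obtain y where "y \<in> {a<..<b}" "\<not> measure M {y} > 0" by blast
  then show ?thesis using that[of y] measure_nonneg[of M "{y}"] by (auto simp: isCont_cdf)
qed


lemma cdf_distr:
  assumes [measurable]: "f \<in> borel_measurable M"
  shows "cdf (distr M borel f) x = measure M {\<omega> \<in> space M. f \<omega> \<le> x}"
  by (simp add: cdf_def measure_distr vimage_def Int_def conj_commute)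

text \<open>Inverting a monotone criterion. The position of \<open>\<tau> n\<close> relative to \<open>x\<close> is decided by the
  position of \<open>Z x n\<close> relative to \<open>c x n\<close>, and the latter is asymptotically that of a variable
  with law \<open>\<mu>\<close> relative to \<open>a * x\<close>. The two implications leave \<open>\<tau> n \<omega> = x\<close> undecided; this costs
  nothing, because the upper bound for \<open>\<tau> n \<omega> \<le> x\<close> can be taken at a slightly larger \<open>x'\<close>.\<close>

lemma (in prob_space) weak_conv_m_by_inversion:
  fixes \<tau> :: "nat \<Rightarrow> 'a \<Rightarrow> real" and Z :: "real \<Rightarrow> nat \<Rightarrow> 'a \<Rightarrow> real"
  assumes \<mu>: "real_distribution \<mu>" and "a > 0"
    and \<tau>: "\<forall>\<^sub>F n in sequentially. \<tau> n \<in> borel_measurable M"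
    and Z [measurable]: "\<And>x n. Z x n \<in> borel_measurable M"
    and conv: "\<And>x. weak_conv_m (\<lambda>n. distr M borel (Z x n)) \<mu>"
    and c: "\<And>x. c x \<longlonglongrightarrow> a * x"
    and below: "\<And>x. \<forall>\<^sub>F n in sequentially. AE \<omega> in M. Z x n \<omega> < c x n \<longrightarrow> \<tau> n \<omega> \<le> x"
    and above: "\<And>x. \<forall>\<^sub>F n in sequentially. AE \<omega> in M. \<tau> n \<omega> < x \<longrightarrow> Z x n \<omega> \<le> c x n"
  shows "weak_conv_m (\<lambda>n. distr M borel (\<tau> n)) (distr \<mu> borel (\<lambda>y. y / a))"
  unfolding weak_conv_m_def weak_conv_def
proof (intro allI impI)
  interpret \<mu>: real_distribution \<mu> by (rule \<mu>)
  have cdf: "cdf (distr \<mu> borel (\<lambda>y. y / a)) z = cdf \<mu> (a * z)" for z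
  proof -
    have "{y. y / a \<le> z} = {..a * z}"
      using \<open>a > 0\<close> by (auto simp: field_simps)
    then show ?thesis by (subst cdf_distr) (simp_all add: cdf_def)
  qed
  fix x assume x: "isCont (cdf (distr \<mu> borel (\<lambda>y. y / a))) x"
  have "isCont (\<lambda>y. y / a) (a * x)"
    using \<open>a > 0\<close> by (intro isCont_divide continuous_ident continuous_const) simp_all
  moreover have "isCont (cdf (distr \<mu> borel (\<lambda>y. y / a))) (a * x / a)"
    using x \<open>a > 0\<close> by simp
  ultimately have "isCont (\<lambda>y. cdf (distr \<mu> borel (\<lambda>y. y / a)) (y / a)) (a * x)"
    by (rule isCont_o2)
  then have "isCont (cdf \<mu>) (a * x)"
    using \<open>a > 0\<close> by (simp add: cdf)
  then have cont: "(cdf \<mu> \<longlongrightarrow> cdf \<mu> (a * x)) (nhds (a * x))"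
    by (simp add: isCont_def tendsto_at_iff_tendsto_nhds)
  have Z_lim: "(\<lambda>n. prob {\<omega> \<in> space M. Z z n \<omega> \<le> y}) \<longlonglongrightarrow> cdf \<mu> y" if "isCont (cdf \<mu>) y" for z y
    using conv[of z] that by (simp add: weak_conv_m_def weak_conv_def cdf_distr)
  have "(\<lambda>n. prob {\<omega> \<in> space M. \<tau> n \<omega> \<le> x}) \<longlonglongrightarrow> cdf \<mu> (a * x)"
  proof (rule order_tendstoI)
    fix u assume "u < cdf \<mu> (a * x)"
    then obtain d where "d > 0" and d: "\<And>y. dist y (a * x) < d \<Longrightarrow> u < cdf \<mu> y"
      using order_tendstoD(1)[OF cont] by (auto simp: eventually_nhds_metric)
    obtain y where y: "a * x - d < y" "y < a * x" "isCont (cdf \<mu>) y"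
      using \<mu>.isCont_cdf_dense[of "a * x - d" "a * x"] \<open>d > 0\<close> by auto
    then have "u < cdf \<mu> y" by (intro d) (simp add: dist_real_def)
    then have "\<forall>\<^sub>F n in sequentially. u < prob {\<omega> \<in> space M. Z x n \<omega> \<le> y}"
      by (rule order_tendstoD(1)[OF Z_lim[OF y(3)]])
    moreover have "\<forall>\<^sub>F n in sequentially. y < c x n"
      by (rule order_tendstoD(1)[OF c y(2)])
    ultimately show "\<forall>\<^sub>F n in sequentially. u < prob {\<omega> \<in> space M. \<tau> n \<omega> \<le> x}"
      using below[of x] \<tau>
    proof eventually_elim
      case (elim n)
      note [measurable] = elim(4)
      have "AE \<omega> in M. \<omega> \<in> {\<omega> \<in> space M. Z x n \<omega> \<le> y} \<longrightarrow> \<omega> \<in> {\<omega> \<in> space M. \<tau> n \<omega> \<le> x}"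
        using elim(3) by eventually_elim (use elim(2) in auto)
      then have "prob {\<omega> \<in> space M. Z x n \<omega> \<le> y} \<le> prob {\<omega> \<in> space M. \<tau> n \<omega> \<le> x}"
        by (rule finite_measure_mono_AE) measurable
      with elim(1) show ?case by linarith
    qed
  next
    fix u assume "cdf \<mu> (a * x) < u"
    then obtain d where "d > 0" and d: "\<And>y. dist y (a * x) < d \<Longrightarrow> cdf \<mu> y < u"
      using order_tendstoD(2)[OF cont] by (auto simp: eventually_nhds_metric)
    obtain y where y: "a * x < y" "y < a * x + d" "isCont (cdf \<mu>) y"
      using \<mu>.isCont_cdf_dense[of "a * x" "a * x + d"] \<open>d > 0\<close> by auto
    \<comment> \<open>The criterion only controls strict inequalities \<open>\<tau> n \<omega> < x'\<close>, hence the detour over \<open>x' > x\<close>.\<close>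
    have "x < y / a" using y(1) \<open>a > 0\<close> by (simp add: field_simps)
    then obtain x' where x': "x < x'" "x' < y / a" using dense by blast
    then have "a * x' < y" using \<open>a > 0\<close> by (simp add: field_simps)
    have "cdf \<mu> y < u" using y by (intro d) (simp add: dist_real_def)
    then have "\<forall>\<^sub>F n in sequentially. prob {\<omega> \<in> space M. Z x' n \<omega> \<le> y} < u"
      by (rule order_tendstoD(2)[OF Z_lim[OF y(3)]])
    moreover have "\<forall>\<^sub>F n in sequentially. c x' n < y"
      by (rule order_tendstoD(2)[OF c \<open>a * x' < y\<close>])
    ultimately show "\<forall>\<^sub>F n in sequentially. prob {\<omega> \<in> space M. \<tau> n \<omega> \<le> x} < u"
      using above[of x'] \<tau>
    proof eventually_elim
      case (elim n)
      note [measurable] = elim(4)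
      have "AE \<omega> in M. \<omega> \<in> {\<omega> \<in> space M. \<tau> n \<omega> \<le> x} \<longrightarrow> \<omega> \<in> {\<omega> \<in> space M. Z x' n \<omega> \<le> y}"
        using elim(3) by eventually_elim (use elim(2) x'(1) in auto)
      then have "prob {\<omega> \<in> space M. \<tau> n \<omega> \<le> x} \<le> prob {\<omega> \<in> space M. Z x' n \<omega> \<le> y}"
        by (rule finite_measure_mono_AE) measurable
      with elim(1) show ?case by linarith
    qed
  qed
  moreover have "\<forall>\<^sub>F n in sequentially.
      prob {\<omega> \<in> space M. \<tau> n \<omega> \<le> x} = cdf (distr M borel (\<tau> n)) x"
    using \<tau> by eventually_elim (simp add: cdf_distr)
  ultimately show "(\<lambda>n. cdf (distr M borel (\<tau> n)) x)
      \<longlonglongrightarrow> cdf (distr \<mu> borel (\<lambda>y. y / a)) x"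
    unfolding cdf by (rule Lim_transform_eventually)
qed

lemma (in prob_space) indep_vars_reindex:
  assumes inj: "inj_on f I" and indep: "indep_vars M' X (f ` I)"
  shows "indep_vars (\<lambda>i. M' (f i)) (\<lambda>i. X (f i)) I"
  unfolding indep_vars_def2 indep_sets_def
proof (intro conjI ballI allI impI)
  show "random_variable (M' (f i)) (X (f i))" if "i \<in> I" for i
    using indep that by (auto simp: indep_vars_def2)
  show "{X (f i) -` A \<inter> space M |A. A \<in> sets (M' (f i))} \<subseteq> events" if "i \<in> I" for i
    using indep that by (auto simp: indep_vars_def2 intro: measurable_sets)
  fix J A
  assume J: "J \<subseteq> I" "J \<noteq> {}" "finite J"
    and A: "A \<in> (\<Pi> i\<in>J. {X (f i) -` A \<inter> space M |A. A \<in> sets (M' (f i))})"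
  have injJ: "inj_on f J" using inj J(1) by (rule inj_on_subset)
  define B where "B k = A (the_inv_into J f k)" for k
  have BA: "B (f j) = A j" if "j \<in> J" for j
    using the_inv_into_f_f[OF injJ that] by (simp add: B_def)
  have "indep_sets (\<lambda>k. {X k -` A \<inter> space M |A. A \<in> sets (M' k)}) (f ` I)"
    using indep by (simp add: indep_vars_def2)
  moreover have "f ` J \<subseteq> f ` I" "f ` J \<noteq> {}" "finite (f ` J)"
    using J by auto
  moreover have "B \<in> (\<Pi> k\<in>f ` J. {X k -` A \<inter> space M |A. A \<in> sets (M' k)})"
    using A BA by (auto simp: Pi_iff)
  ultimately have "prob (\<Inter>k\<in>f ` J. B k) = (\<Prod>k\<in>f ` J. prob (B k))"
    unfolding indep_sets_def by blast
  then show "prob (\<Inter>j\<in>J. A j) = (\<Prod>j\<in>J. prob (A j))"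
    using BA by (simp add: prod.reindex[OF injJ])
qed

section \<open>The expected score\<close>

text \<open>This is applied to \<open>\<phi> t = E [l' (\<xi> - t)]\<close> and to the expectation \<open>\<psi> t\<close> of a measurable version
  of the same integrand. Where the integrand of \<open>\<phi>\<close> fails to be measurable, its integral is \<open>0\<close> by
  convention; a nonzero derivative of \<open>\<phi>\<close> at \<open>a\<close> excludes this near \<open>a\<close>. Indeed, if \<open>\<phi> a = 0\<close> then
  \<open>\<phi>\<close> would be nonzero at all other points near \<open>a\<close>, hence equal to \<open>\<psi>\<close> there, so that the continuous
  function \<open>\<psi>\<close> would vanish at \<open>a\<close>.\<close>

lemma has_real_derivative_of_zero_or_eq:
  fixes \<phi> \<psi> :: "real \<Rightarrow> real"
  assumes deriv: "(\<phi> has_real_derivative D) (at a)" and "D \<noteq> 0"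
    and \<psi>: "isCont \<psi> a" "\<psi> a \<noteq> 0"
    and U: "open U" "a \<in> U" "\<And>t. t \<in> U \<Longrightarrow> \<phi> t = 0 \<or> \<phi> t = \<psi> t"
  shows "\<phi> a = \<psi> a \<and> (\<psi> has_real_derivative D) (at a)"
proof -
  have inU: "\<forall>\<^sub>F t in nhds a. t \<in> U" using U by (simp add: eventually_nhds_in_open)
  have \<phi>_cont: "isCont \<phi> a" using deriv by (rule DERIV_isCont)
  have nz: "\<phi> a \<noteq> 0"
  proof
    assume "\<phi> a = 0"
    have "\<forall>\<^sub>F t in at a. (\<phi> t - \<phi> a) / (t - a) \<noteq> 0"
      using deriv \<open>D \<noteq> 0\<close> by (intro tendsto_imp_eventually_ne[of _ D]) (simp add: has_field_derivative_iff)
    moreover have "\<forall>\<^sub>F t in at a. t \<in> U" using U by (simp add: eventually_at_in_open')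
    ultimately have "\<forall>\<^sub>F t in at a. \<phi> t = \<psi> t"
      by eventually_elim (use U(3) \<open>\<phi> a = 0\<close> in auto)
    moreover have "(\<phi> \<longlongrightarrow> 0) (at a)" using \<phi>_cont \<open>\<phi> a = 0\<close> by (simp add: isCont_def)
    ultimately have "(\<psi> \<longlongrightarrow> 0) (at a)" by (simp add: tendsto_cong)
    then have "\<psi> a = 0" using \<psi>(1) tendsto_unique[of "at a" \<psi>] by (auto simp: isCont_def)
    with \<psi>(2) show False by simp
  qed
  have "(\<phi> \<longlongrightarrow> \<phi> a) (nhds a)"
    using \<phi>_cont by (simp add: isCont_def tendsto_at_iff_tendsto_nhds)
  then have "\<forall>\<^sub>F t in nhds a. \<phi> t \<noteq> 0" using nz by (rule tendsto_imp_eventually_ne)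
  with inU have "\<forall>\<^sub>F t in nhds a. \<phi> t = \<psi> t"
    by eventually_elim (use U(3) in auto)
  then show ?thesis
    using deriv nz U(2,3) DERIV_cong_ev[of a a \<phi> \<psi> D D] by auto
qed

lemma integral_AE_eq_cases:
  fixes f g :: "'a \<Rightarrow> real"
  assumes g: "g \<in> borel_measurable M" and eq: "AE \<omega> in M. f \<omega> = g \<omega>"
  shows "integral\<^sup>L M f = 0 \<or> integral\<^sup>L M f = integral\<^sup>L M g"
proof (cases "integrable M f")
  case True
  then show ?thesis using g eq by (auto intro: integral_cong_AE)
qed (simp add: not_integrable_integral_eq)

context extended_convex_loss
begin

lemma finite_second_moment:
  assumes prob: "prob_space M" and \<xi> [measurable]: "\<xi> \<in> borel_measurable M"
    and fin: "(\<integral>\<^sup>+ \<omega>. e2ennreal ((l (\<xi> \<omega> - t))\<^sup>2) \<partial>M) < \<infinity>"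
  shows "AE \<omega> in M. \<xi> \<omega> - t \<in> edom" "integrable M (\<lambda>\<omega>. fin_loss (\<xi> \<omega> - t))"
proof -
  interpret prob_space M by (rule prob)
  define F where "F z = (if z \<in> edom then ennreal ((fin_loss z)\<^sup>2) else \<infinity>)" for z
  have [measurable]: "F \<in> borel_measurable borel"
    unfolding F_def[abs_def] by measurable
  have "e2ennreal ((l z)\<^sup>2) = F z" for z
  proof (cases "z \<in> edom")
    case True
    then show ?thesis by (simp add: F_def l_eq_fin_loss)
  next
    case False
    then have "l z = \<infinity>" by (simp add: edom_def)
    with False show ?thesis by (simp add: F_def)
  qed
  with fin have fin': "(\<integral>\<^sup>+ \<omega>. F (\<xi> \<omega> - t) \<partial>M) < \<infinity>" by simp
  then have "AE \<omega> in M. F (\<xi> \<omega> - t) \<noteq> \<infinity>"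
    by (intro nn_integral_PInf_AE) auto
  then show dom: "AE \<omega> in M. \<xi> \<omega> - t \<in> edom"
    by eventually_elim (auto simp: F_def split: if_splits)
  have "(\<integral>\<^sup>+ \<omega>. ennreal ((fin_loss (\<xi> \<omega> - t))\<^sup>2) \<partial>M) = (\<integral>\<^sup>+ \<omega>. F (\<xi> \<omega> - t) \<partial>M)"
    using dom by (intro nn_integral_cong_AE) (auto simp: F_def)
  then have "integrable M (\<lambda>\<omega>. (fin_loss (\<xi> \<omega> - t))\<^sup>2)"
    using fin' by (intro integrableI_nonneg) auto
  then show "integrable M (\<lambda>\<omega>. fin_loss (\<xi> \<omega> - t))"
    by (rule square_integrable_imp_integrable[rotated]) simp
qed

lemma oce_objective_eq:
  assumes \<xi> [measurable]: "\<xi> \<in> borel_measurable M"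
    and dom: "AE \<omega> in M. \<xi> \<omega> - t \<in> edom" and int: "integrable M (\<lambda>\<omega>. fin_loss (\<xi> \<omega> - t))"
  shows "oce_objective M l \<xi> t = ereal (t + (\<integral>\<omega>. fin_loss (\<xi> \<omega> - t) \<partial>M))"
proof -
  have pos: "(\<integral>\<^sup>+ \<omega>. e2ennreal (l (\<xi> \<omega> - t)) \<partial>M) = (\<integral>\<^sup>+ \<omega>. ennreal (fin_loss (\<xi> \<omega> - t)) \<partial>M)"
    using dom by (intro nn_integral_cong_AE) (auto simp: l_eq_fin_loss)
  have neg: "(\<integral>\<^sup>+ \<omega>. e2ennreal (- l (\<xi> \<omega> - t)) \<partial>M) = (\<integral>\<^sup>+ \<omega>. ennreal (- fin_loss (\<xi> \<omega> - t)) \<partial>M)"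
    using dom by (intro nn_integral_cong_AE) (auto simp: l_eq_fin_loss)
  have fin: "(\<integral>\<^sup>+ \<omega>. ennreal (fin_loss (\<xi> \<omega> - t)) \<partial>M) \<noteq> \<infinity>"
    "(\<integral>\<^sup>+ \<omega>. ennreal (- fin_loss (\<xi> \<omega> - t)) \<partial>M) \<noteq> \<infinity>"
    using real_integrable_def[of M "\<lambda>\<omega>. fin_loss (\<xi> \<omega> - t)"] int by auto
  have enn: "enn2ereal x = ereal (enn2real x)" if "x \<noteq> \<infinity>" for x
    using that by (cases x) auto
  show ?thesis
    unfolding oce_objective_def ext_expectation_def pos neg real_lebesgue_integral_def[OF int]
    by (simp add: enn[OF fin(1)] enn[OF fin(2)])
qed

text \<open>Dominated convergence with the majorant \<open>4 * (k \<omega>)\<^sup>2\<close>. Convergence in \<open>L\<^sup>2\<close> serves twice: for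
  the continuity of the expected score and for the drifting central limit theorem.\<close>

lemma score_L2_continuous:
  assumes \<xi> [measurable]: "\<xi> \<in> borel_measurable M"
    and k: "integrable M (\<lambda>\<omega>. (k \<omega>)\<^sup>2)"
    and U: "open U" "a \<in> U" "\<And>t. t \<in> U \<Longrightarrow> AE \<omega> in M. \<bar>score (\<xi> \<omega> - t)\<bar> \<le> k \<omega>"
    and cont: "AE \<omega> in M. isCont (\<lambda>s. score (\<xi> \<omega> - s)) a"
    and s: "s \<longlonglongrightarrow> a"
  shows "(\<lambda>n. \<integral>\<omega>. (score (\<xi> \<omega> - s n) - score (\<xi> \<omega> - a))\<^sup>2 \<partial>M) \<longlonglongrightarrow> 0"
proof -
  have inU: "\<forall>\<^sub>F n in sequentially. s n \<in> U"
    using s U(1,2) by (rule topological_tendstoD)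
  \<comment> \<open>The finitely many terms outside \<open>U\<close> are replaced so that the bound holds for every index.\<close>
  define r where "r n = (if s n \<in> U then s n else a)" for n
  have rU: "r n \<in> U" for n using U(2) by (simp add: r_def)
  have rs: "\<forall>\<^sub>F n in sequentially. r n = s n"
    using inU by eventually_elim (simp add: r_def)
  then have r: "r \<longlonglongrightarrow> a"
    using s by (simp add: tendsto_cong)
  have "(\<lambda>n. \<integral>\<omega>. (score (\<xi> \<omega> - r n) - score (\<xi> \<omega> - a))\<^sup>2 \<partial>M) \<longlonglongrightarrow> (\<integral>\<omega>. 0 \<partial>M)"
  proof (rule integral_dominated_convergence[where w="\<lambda>\<omega>. 4 * (k \<omega>)\<^sup>2"])
    show "integrable M (\<lambda>\<omega>. 4 * (k \<omega>)\<^sup>2)" using k by simp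
    show "AE \<omega> in M. (\<lambda>n. (score (\<xi> \<omega> - r n) - score (\<xi> \<omega> - a))\<^sup>2) \<longlonglongrightarrow> 0"
      using cont
    proof eventually_elim
      case (elim \<omega>)
      have "(\<lambda>n. score (\<xi> \<omega> - r n)) \<longlonglongrightarrow> score (\<xi> \<omega> - a)"
        using isCont_tendsto_compose[OF elim r] .
      then have "(\<lambda>n. (score (\<xi> \<omega> - r n) - score (\<xi> \<omega> - a))\<^sup>2)
          \<longlonglongrightarrow> (score (\<xi> \<omega> - a) - score (\<xi> \<omega> - a))\<^sup>2"
        by (intro tendsto_intros)
      then show ?case by simp
    qed
    show "AE \<omega> in M. norm ((score (\<xi> \<omega> - r n) - score (\<xi> \<omega> - a))\<^sup>2) \<le> 4 * (k \<omega>)\<^sup>2" for n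
      using U(3)[OF rU[of n]] U(3)[OF U(2)]
    proof eventually_elim
      case (elim \<omega>)
      then have "\<bar>score (\<xi> \<omega> - r n) - score (\<xi> \<omega> - a)\<bar> \<le> \<bar>2 * k \<omega>\<bar>" by linarith
      then have "(score (\<xi> \<omega> - r n) - score (\<xi> \<omega> - a))\<^sup>2 \<le> (2 * k \<omega>)\<^sup>2"
        by (simp only: abs_le_square_iff)
      then show ?case by (simp add: power_mult_distrib)
    qed
  qed measurable
  moreover have "\<forall>\<^sub>F n in sequentially. (\<integral>\<omega>. (score (\<xi> \<omega> - r n) - score (\<xi> \<omega> - a))\<^sup>2 \<partial>M)
      = (\<integral>\<omega>. (score (\<xi> \<omega> - s n) - score (\<xi> \<omega> - a))\<^sup>2 \<partial>M)"
    using rs by eventually_elim simp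
  ultimately show ?thesis
    using Lim_transform_eventually by fastforce
qed

lemma square_integrable_score:
  assumes [measurable]: "\<xi> \<in> borel_measurable M" and k: "integrable M (\<lambda>\<omega>. (k \<omega>)\<^sup>2)"
    and b: "AE \<omega> in M. \<bar>score (\<xi> \<omega> - t)\<bar> \<le> k \<omega>"
  shows "integrable M (\<lambda>\<omega>. (score (\<xi> \<omega> - t))\<^sup>2)"
proof (rule Bochner_Integration.integrable_bound[OF k])
  show "AE \<omega> in M. norm ((score (\<xi> \<omega> - t))\<^sup>2) \<le> norm ((k \<omega>)\<^sup>2)"
    using b by eventually_elim (simp add: abs_le_square_iff[symmetric])
qed measurable

lemma isCont_expected_score:
  assumes prob: "prob_space M" and \<xi> [measurable]: "\<xi> \<in> borel_measurable M"
    and k: "integrable M (\<lambda>\<omega>. (k \<omega>)\<^sup>2)"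
    and U: "open U" "a \<in> U" "\<And>t. t \<in> U \<Longrightarrow> AE \<omega> in M. \<bar>score (\<xi> \<omega> - t)\<bar> \<le> k \<omega>"
    and cont: "AE \<omega> in M. isCont (\<lambda>s. score (\<xi> \<omega> - s)) a"
  shows "isCont (\<lambda>t. \<integral>\<omega>. score (\<xi> \<omega> - t) \<partial>M) a"
  unfolding continuous_at_sequentially comp_def
proof (intro allI impI)
  interpret prob_space M by (rule prob)
  fix s assume s: "s \<longlonglongrightarrow> a"
  let ?d = "\<lambda>n \<omega>. score (\<xi> \<omega> - s n) - score (\<xi> \<omega> - a)"
  have sq: "integrable M (\<lambda>\<omega>. (score (\<xi> \<omega> - t))\<^sup>2)" if "t \<in> U" for t
    using square_integrable_score[OF \<xi> k U(3)[OF that]] .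
  have int: "integrable M (\<lambda>\<omega>. score (\<xi> \<omega> - t))" if "t \<in> U" for t
    by (rule square_integrable_imp_integrable[OF _ sq[OF that]]) simp
  have lim: "(\<lambda>n. sqrt (\<integral>\<omega>. (?d n \<omega>)\<^sup>2 \<partial>M)) \<longlonglongrightarrow> 0"
    using tendsto_real_sqrt[OF score_L2_continuous[OF \<xi> k U cont s]] by simp
  have "\<forall>\<^sub>F n in sequentially. s n \<in> U"
    using s U(1,2) by (rule topological_tendstoD)
  then have "\<forall>\<^sub>F n in sequentially.
      norm ((\<integral>\<omega>. score (\<xi> \<omega> - s n) \<partial>M) - (\<integral>\<omega>. score (\<xi> \<omega> - a) \<partial>M)) \<le> sqrt (\<integral>\<omega>. (?d n \<omega>)\<^sup>2 \<partial>M)"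
  proof eventually_elim
    case (elim n)
    have "integrable M (\<lambda>\<omega>. (?d n \<omega>)\<^sup>2)"
    proof (rule Bochner_Integration.integrable_bound)
      show "integrable M (\<lambda>\<omega>. 2 * (score (\<xi> \<omega> - s n))\<^sup>2 + 2 * (score (\<xi> \<omega> - a))\<^sup>2)"
        using sq elim U(2) by simp
      have "(a - b)\<^sup>2 \<le> 2 * a\<^sup>2 + 2 * b\<^sup>2" for a b :: real
        using zero_le_power2[of "a + b"] by (simp add: power2_diff power2_sum)
      then show "AE \<omega> in M. norm ((?d n \<omega>)\<^sup>2)
          \<le> norm (2 * (score (\<xi> \<omega> - s n))\<^sup>2 + 2 * (score (\<xi> \<omega> - a))\<^sup>2)"
        by (intro AE_I2) (simp add: abs_of_nonneg)
    qed measurable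
    then have "(\<integral>\<omega>. \<bar>?d n \<omega>\<bar> \<partial>M) \<le> sqrt (\<integral>\<omega>. (?d n \<omega>)\<^sup>2 \<partial>M)"
      by (intro expectation_abs_le_sqrt) measurable
    moreover have "norm (\<integral>\<omega>. ?d n \<omega> \<partial>M) \<le> (\<integral>\<omega>. \<bar>?d n \<omega>\<bar> \<partial>M)"
      using integral_norm_bound[of M "?d n"] by simp
    ultimately show ?case
      using int elim U(2) by simp
  qed
  then have "(\<lambda>n. (\<integral>\<omega>. score (\<xi> \<omega> - s n) \<partial>M) - (\<integral>\<omega>. score (\<xi> \<omega> - a) \<partial>M)) \<longlonglongrightarrow> 0"
    by (rule Lim_null_comparison) (rule lim)
  then show "(\<lambda>n. \<integral>\<omega>. score (\<xi> \<omega> - s n) \<partial>M) \<longlonglongrightarrow> (\<integral>\<omega>. score (\<xi> \<omega> - a) \<partial>M)"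
    by (simp only: LIM_zero_iff)
qed

text \<open>The first-order condition at the interior minimizer \<open>a\<close>. Integrating the subgradient inequality
  at \<open>\<xi> - t\<close> and comparing with the optimality of \<open>a\<close> gives \<open>\<psi> t \<le> 1\<close> to the right and \<open>\<psi> t \<ge> 1\<close> to
  the left of \<open>a\<close>; continuity then forces \<open>\<psi> a = 1\<close>, where \<open>\<psi> t\<close> is the expected score at \<open>\<xi> - t\<close>.\<close>

lemma expected_score_eq_1:
  assumes prob: "prob_space M" and \<xi> [measurable]: "\<xi> \<in> borel_measurable M"
    and U: "open U" "a \<in> U" "U \<subseteq> T"
    and opt: "is_arg_min (oce_objective M l \<xi>) (\<lambda>t. t \<in> T) a"
    and dom: "\<And>t. t \<in> U \<Longrightarrow> AE \<omega> in M. \<xi> \<omega> - t \<in> interior edom"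
    and int_loss: "\<And>t. t \<in> U \<Longrightarrow> integrable M (\<lambda>\<omega>. fin_loss (\<xi> \<omega> - t))"
    and int_score: "\<And>t. t \<in> U \<Longrightarrow> integrable M (\<lambda>\<omega>. score (\<xi> \<omega> - t))"
    and cont: "isCont (\<lambda>t. \<integral>\<omega>. score (\<xi> \<omega> - t) \<partial>M) a"
  shows "(\<integral>\<omega>. score (\<xi> \<omega> - a) \<partial>M) = 1"
proof -
  interpret prob_space M by (rule prob)
  let ?\<psi> = "\<lambda>t. \<integral>\<omega>. score (\<xi> \<omega> - t) \<partial>M"
  have dom': "AE \<omega> in M. \<xi> \<omega> - t \<in> edom" if "t \<in> U" for t
    using dom[OF that] interior_subset by (auto elim!: eventually_mono)
  have key: "(t - a) * ?\<psi> t \<le> t - a" if "t \<in> U" for t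
  proof -
    have "oce_objective M l \<xi> a \<le> oce_objective M l \<xi> t"
      using opt that U by (auto simp: is_arg_min_def not_less)
    then have "a + (\<integral>\<omega>. fin_loss (\<xi> \<omega> - a) \<partial>M) \<le> t + (\<integral>\<omega>. fin_loss (\<xi> \<omega> - t) \<partial>M)"
      using that U by (simp add: oce_objective_eq[OF \<xi> dom' int_loss])
    moreover have "(\<integral>\<omega>. fin_loss (\<xi> \<omega> - t) + score (\<xi> \<omega> - t) * (t - a) \<partial>M)
        \<le> (\<integral>\<omega>. fin_loss (\<xi> \<omega> - a) \<partial>M)"
    proof (rule integral_mono_AE)
      show "AE \<omega> in M. fin_loss (\<xi> \<omega> - t) + score (\<xi> \<omega> - t) * (t - a) \<le> fin_loss (\<xi> \<omega> - a)"
        using dom[OF that] dom'[OF U(2)]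
      proof eventually_elim
        case (elim \<omega>)
        then show ?case using score_subgradient_edom[OF elim] by simp
      qed
    qed (use int_loss int_score that U in auto)
    moreover have "(\<integral>\<omega>. fin_loss (\<xi> \<omega> - t) + score (\<xi> \<omega> - t) * (t - a) \<partial>M)
        = (\<integral>\<omega>. fin_loss (\<xi> \<omega> - t) \<partial>M) + ?\<psi> t * (t - a)"
      using int_loss int_score that by simp
    ultimately show ?thesis by (simp add: mult.commute)
  qed
  have lim: "(?\<psi> \<longlongrightarrow> ?\<psi> a) (at a within S)" for S
    using cont by (meson continuous_at_imp_continuous_at_within continuous_within)
  have inU: "\<forall>\<^sub>F t in at a within S. t \<in> U" for S
    using U(1,2) by (meson eventually_at_topological)
  have "?\<psi> a \<le> 1"
  proof (rule tendsto_upperbound[OF lim])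
    show "\<forall>\<^sub>F t in at_right a. ?\<psi> t \<le> 1"
      using inU eventually_at_right_less[of a]
    proof eventually_elim
      case (elim t)
      then have "(t - a) * ?\<psi> t \<le> (t - a) * 1" using key by simp
      with elim show ?case by (simp only: mult_le_cancel_left_pos diff_gt_0_iff_gt)
    qed
  qed simp
  moreover have "?\<psi> a \<ge> 1"
  proof (rule tendsto_lowerbound[OF lim])
    have "\<forall>\<^sub>F t in at_left a. t < a" by (simp add: eventually_at_filter)
    with inU show "\<forall>\<^sub>F t in at_left a. 1 \<le> ?\<psi> t"
    proof eventually_elim
      case (elim t)
      then have "(a - t) * 1 \<le> (a - t) * ?\<psi> t" using key[of t] by (simp add: algebra_simps)
      with elim show ?case by (simp only: mult_le_cancel_left_pos diff_gt_0_iff_gt)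
    qed
  qed simp
  ultimately show ?thesis by simp
qed

end

section \<open>Asymptotic normality of the sample minimizer\<close>

theorem proposition4:
  fixes u l :: "real \<Rightarrow> ereal"
    and M :: "'a measure"
    and \<xi> :: "'a \<Rightarrow> real"
    and X :: "nat \<Rightarrow> 'a \<Rightarrow> real"
    and T :: "real set"
    and tn :: "nat \<Rightarrow> 'a \<Rightarrow> real"
    and tstar D \<sigma>2 :: real
    and K :: "real \<Rightarrow> real"
  assumes u_concave: "proper_closed_concave u"
    and u_mono: "mono u"
    and u_zero: "u 0 = 0"
    and u_subdiff: "1 \<in> concave_subdifferential u 0"
    and l_eq: "\<And>z. l z = - u (- z)"
    and prob: "prob_space M"
    and xi_rv: "\<xi> \<in> borel_measurable M"
    and X_indep: "prob_space.indep_vars M (\<lambda>_. borel) X {1..}"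
    and X_distr: "\<And>i. i \<ge> 1 \<Longrightarrow> distr M borel (X i) = distr M borel \<xi>"
    and T_compact: "compact T"
    and T_interval: "is_interval T"
    and T_reasonable: "tstar \<in> interior T"
    and S_singleton: "{t. is_arg_min (oce_objective M l \<xi>) (\<lambda>t. t \<in> T) t} = {tstar}"
    and tn_rv: "\<And>n. n \<ge> 1 \<Longrightarrow> tn n \<in> borel_measurable M"
    and tn_opt: "\<And>n. n \<ge> 1 \<Longrightarrow>
      AE \<omega> in M. is_arg_min (saa_objective l (\<lambda>i. X i \<omega>) n) (\<lambda>t. t \<in> T) (tn n \<omega>)"
    and second_moment: "(SUP t\<in>T. \<integral>\<^sup>+ \<omega>. e2ennreal ((l (\<xi> \<omega> - t))\<^sup>2) \<partial>M) < \<infinity>"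
    and K_meas: "K \<in> borel_measurable borel"
    and K_square: "integrable M (\<lambda>\<omega>. (K (\<xi> \<omega>))\<^sup>2)"
    and l_lipschitz: "AE \<omega> in M. \<forall>t1\<in>T. \<forall>t2\<in>T.
      \<bar>l (\<xi> \<omega> - t1) - l (\<xi> \<omega> - t2)\<bar> \<le> ereal (K (\<xi> \<omega>) * \<bar>t1 - t2\<bar>)"
    and l_C1: "\<And>t. t \<in> interior T \<Longrightarrow>
      AE \<omega> in M. continuously_differentiable_at (\<lambda>s. l (\<xi> \<omega> - s)) t"
    and D_deriv: "((\<lambda>t. prob_space.expectation M (\<lambda>\<omega>. ext_deriv l (\<xi> \<omega> - t)))
      has_real_derivative D) (at tstar)"
    and D_neg: "D < 0"
    and sigma2_eq: "\<sigma>2 = prob_space.variance M (\<lambda>\<omega>. ext_deriv l (\<xi> \<omega> - tstar)) / D\<^sup>2"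
  shows "weak_conv_m (\<lambda>n. distr M borel (\<lambda>\<omega>. sqrt (real n) * (tn n \<omega> - tstar)))
           (normal_law 0 \<sigma>2)"
proof -
  interpret prob_space M by (rule prob)
  interpret extended_convex_loss l
    by (rule extended_convex_loss_of_utility[OF u_concave u_mono l_eq])
  note [measurable] = xi_rv K_meas
  let ?U = "interior T"
  have UT: "?U \<subseteq> T" by (rule interior_subset)

  have C1: "AE \<omega> in M. \<xi> \<omega> - t \<in> interior edom"
    "AE \<omega> in M. score (\<xi> \<omega> - t) = ext_deriv l (\<xi> \<omega> - t)"
    "AE \<omega> in M. isCont (\<lambda>s. score (\<xi> \<omega> - s)) t" if "t \<in> ?U" for t
    using l_C1[OF that] by (eventually_elim, simp add: continuously_differentiable_at_score)+
  have bound: "AE \<omega> in M. \<bar>score (\<xi> \<omega> - t)\<bar> \<le> K (\<xi> \<omega>)" if "t \<in> ?U" for t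
    using C1(1)[OF that] l_lipschitz
    by eventually_elim (rule abs_score_le_lipschitz[OF that])
  have sq: "integrable M (\<lambda>\<omega>. (score (\<xi> \<omega> - t))\<^sup>2)" if "t \<in> ?U" for t
    using square_integrable_score[OF xi_rv K_square bound[OF that]] .
  have int_score: "integrable M (\<lambda>\<omega>. score (\<xi> \<omega> - t))" if "t \<in> ?U" for t
    by (rule square_integrable_imp_integrable[OF _ sq[OF that]]) simp
  have "(\<integral>\<^sup>+ \<omega>. e2ennreal ((l (\<xi> \<omega> - t))\<^sup>2) \<partial>M) < \<infinity>" if "t \<in> T" for t
    using SUP_upper[OF that, of "\<lambda>t. \<integral>\<^sup>+ \<omega>. e2ennreal ((l (\<xi> \<omega> - t))\<^sup>2) \<partial>M"] second_moment
    by (rule le_less_trans)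
  from finite_second_moment[OF prob xi_rv this]
  have int_loss: "integrable M (\<lambda>\<omega>. fin_loss (\<xi> \<omega> - t))" if "t \<in> T" for t
    using that by blast

  define \<psi> where "\<psi> t = expectation (\<lambda>\<omega>. score (\<xi> \<omega> - t))" for t
  have \<psi>_cont: "isCont \<psi> tstar"
    unfolding \<psi>_def[abs_def]
    by (rule isCont_expected_score[OF prob xi_rv K_square open_interior T_reasonable bound
          C1(3)[OF T_reasonable]])
  have opt: "is_arg_min (oce_objective M l \<xi>) (\<lambda>t. t \<in> T) tstar"
    using S_singleton by blast
  have \<psi>_1: "\<psi> tstar = 1"
    unfolding \<psi>_def
    by (rule expected_score_eq_1[OF prob xi_rv open_interior T_reasonable UT opt C1(1) _ int_score])
      (use int_loss UT \<psi>_cont in \<open>auto simp: \<psi>_def[abs_def]\<close>)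

  \<comment> \<open>The hypotheses on \<open>D\<close> and \<open>\<sigma>2\<close> speak of \<^const>\<open>ext_deriv\<close>; they are carried over to the score:
    nonzero integrals can only come from integrable, hence measurable, integrands.\<close>
  have "AE \<omega> in M. ext_deriv l (\<xi> \<omega> - t) = score (\<xi> \<omega> - t)" if "t \<in> ?U" for t
    using C1(2)[OF that] by eventually_elim simp
  note cases = integral_AE_eq_cases[OF _ this]
  have "expectation (\<lambda>\<omega>. ext_deriv l (\<xi> \<omega> - t)) = 0
      \<or> expectation (\<lambda>\<omega>. ext_deriv l (\<xi> \<omega> - t)) = \<psi> t" if "t \<in> ?U" for t
    unfolding \<psi>_def using that by (intro cases) auto
  from has_real_derivative_of_zero_or_eq[OF D_deriv _ \<psi>_cont _ open_interior T_reasonable this]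
  have mean_eq: "expectation (\<lambda>\<omega>. ext_deriv l (\<xi> \<omega> - tstar)) = \<psi> tstar"
    and \<psi>_deriv: "(\<psi> has_real_derivative D) (at tstar)"
    using D_neg \<psi>_1 by auto
  have "integrable M (\<lambda>\<omega>. ext_deriv l (\<xi> \<omega> - tstar))"
    using mean_eq \<psi>_1 not_integrable_integral_eq by fastforce
  then have [measurable]: "(\<lambda>\<omega>. ext_deriv l (\<xi> \<omega> - tstar)) \<in> borel_measurable M"
    by (rule borel_measurable_integrable)
  have var_eq: "variance (\<lambda>\<omega>. ext_deriv l (\<xi> \<omega> - tstar)) = variance (\<lambda>\<omega>. score (\<xi> \<omega> - tstar))"
    unfolding mean_eq \<psi>_def
    by (rule integral_cong_AE) (use C1(2)[OF T_reasonable] in \<open>auto elim: eventually_mono\<close>)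

  define Y where "Y i = X (Suc i)" for i
  have "inj_on Suc UNIV" "range Suc = {1..}"
    by (auto simp: image_iff Suc_le_eq gr0_conv_Suc)
  then have Y_indep: "indep_vars (\<lambda>_. borel) Y UNIV"
    using indep_vars_reindex[of Suc UNIV "\<lambda>_. borel" X] X_indep by (simp add: Y_def[abs_def])
  have Y_distr: "distr M borel (Y i) = distr M borel \<xi>" for i
    by (simp add: Y_def X_distr)
  have Y_rv [measurable]: "Y i \<in> borel_measurable M" for i
    using Y_indep by (simp add: indep_vars_def2)
  \<comment> \<open>The interior is open, so this event is determined by the law of \<open>Y i\<close>, which is that of \<open>\<xi>\<close>.\<close>
  have Y_int: "AE \<omega> in M. Y i \<omega> - t \<in> interior edom" if "t \<in> ?U" for i t
  proof -
    have [measurable]: "{z. z - t \<in> interior edom} \<in> sets borel"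
    proof -
      have "(\<lambda>z. z - t) -` interior edom \<inter> space borel \<in> sets borel"
        by (rule measurable_sets[of _ borel borel]) auto
      then show ?thesis by (simp add: vimage_def)
    qed
    have "AE z in distr M borel \<xi>. z - t \<in> interior edom"
      using C1(1)[OF that] by (subst AE_distr_iff) auto
    then show ?thesis
      unfolding Y_distr[of i, symmetric] by (subst (asm) AE_distr_iff) auto
  qed

  \<comment> \<open>On the original scale, \<open>\<tau> n \<omega> \<le> x\<close> (with \<open>\<tau>\<close> the rescaled error) means \<open>tn n \<omega> \<le> s x n\<close>.\<close>
  define s where "s x n = tstar + x / sqrt (real n)" for x and n :: nat
  have s_lim: "s x \<longlonglongrightarrow> tstar" for x
  proof -
    have "(\<lambda>n. x / sqrt (real n)) \<longlonglongrightarrow> 0"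
      by (intro tendsto_divide_0[OF tendsto_const] filterlim_at_top_imp_at_infinity
          filterlim_compose[OF sqrt_at_top] filterlim_real_sequentially)
    from tendsto_add[OF tendsto_const[of tstar] this] show ?thesis
      by (simp add: s_def[abs_def])
  qed
  have s_U: "\<forall>\<^sub>F n in sequentially. s x n \<in> ?U" for x
    using s_lim open_interior T_reasonable by (rule topological_tendstoD)
  define Z where "Z x n \<omega> = (\<Sum>i<n. score (Y i \<omega> - s x n) - \<psi> (s x n)) / sqrt (real n)" for x n \<omega>
  define c where "c x n = sqrt (real n) * (1 - \<psi> (s x n))" for x n
  define \<tau> where "\<tau> n \<omega> = sqrt (real n) * (tn n \<omega> - tstar)" for n \<omega>
  define v where "v = variance (\<lambda>\<omega>. score (\<xi> \<omega> - tstar))"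

  have Z_conv: "weak_conv_m (\<lambda>n. distr M borel (Z x n)) (normal_law 0 v)" for x
  proof -
    have "\<forall>\<^sub>F n in sequentially. integrable M (\<lambda>\<omega>. (score (\<xi> \<omega> - s x n))\<^sup>2)"
      using s_U[of x] by eventually_elim (rule sq)
    from clt_drifting_functions[OF Y_indep xi_rv Y_distr _ _ sq[OF T_reasonable] this
        score_L2_continuous[OF xi_rv K_square open_interior T_reasonable bound
          C1(3)[OF T_reasonable] s_lim]]
    show ?thesis by (simp add: Z_def[abs_def] v_def \<psi>_def)
  qed
  \<comment> \<open>Since \<open>\<psi> tstar = 1\<close>, this is a difference quotient of \<open>\<psi>\<close> at \<open>tstar\<close> with step \<open>x / sqrt n\<close>.\<close>
  have c_lim: "c x \<longlonglongrightarrow> (- D) * x" for x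
  proof (cases "x = 0")
    case True
    then show ?thesis by (simp add: c_def[abs_def] s_def \<psi>_1)
  next
    case False
    have "filterlim (s x) (at tstar) sequentially"
    proof (rule filterlim_atI[OF s_lim])
      show "\<forall>\<^sub>F n in sequentially. s x n \<noteq> tstar"
        using eventually_gt_at_top[of 0] by eventually_elim (use False in \<open>simp add: s_def\<close>)
    qed
    with \<psi>_deriv have "(\<lambda>n. (\<psi> (s x n) - \<psi> tstar) / (s x n - tstar)) \<longlonglongrightarrow> D"
      unfolding has_field_derivative_iff by (rule filterlim_compose)
    then have "(\<lambda>n. (- x) * ((\<psi> (s x n) - \<psi> tstar) / (s x n - tstar))) \<longlonglongrightarrow> (- x) * D"
      by (intro tendsto_intros)
    moreover have "\<forall>\<^sub>F n in sequentially.
        (- x) * ((\<psi> (s x n) - \<psi> tstar) / (s x n - tstar)) = c x n"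
      using eventually_gt_at_top[of 0]
      by eventually_elim (use False in \<open>simp add: c_def \<psi>_1 s_def field_simps\<close>)
    ultimately have "c x \<longlonglongrightarrow> (- x) * D"
      by (rule Lim_transform_eventually)
    then show ?thesis by (simp add: mult.commute)
  qed

  have mono_score: "AE \<omega> in M. (\<tau> n \<omega> - x) * (c x n - Z x n \<omega>) \<le> 0"
    if n: "n \<ge> 1" and sx: "s x n \<in> ?U" for n x
  proof -
    have "AE \<omega> in M. \<forall>i\<in>{1..n}. X i \<omega> - s x n \<in> interior edom"
    proof (rule AE_finite_allI)
      fix i assume "i \<in> {1..n}"
      then show "AE \<omega> in M. X i \<omega> - s x n \<in> interior edom"
        using Y_int[OF sx, of "i - 1"] by (simp add: Y_def)
    qed simp
    with tn_opt[OF n] show ?thesis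
    proof eventually_elim
      case (elim \<omega>)
      have le: "(tn n \<omega> - s x n) * (\<Sum>i = 1..n. 1 - score (X i \<omega> - s x n)) \<le> 0"
        using elim(2) n sx UT by (intro saa_minimizer_score[OF _ _ _ elim(1)]) auto
      \<comment> \<open>The sum of the sample subgradients is \<open>c x n - Z x n \<omega>\<close> up to the factor \<open>sqrt n\<close>.\<close>
      have "sqrt (real n) > 0" using n by simp
      then have "sqrt (real n) * (c x n - Z x n \<omega>)
          = real n * (1 - \<psi> (s x n)) - (\<Sum>i<n. score (Y i \<omega> - s x n) - \<psi> (s x n))"
        by (simp add: c_def Z_def right_diff_distrib mult.assoc[symmetric])
      also have "\<dots> = (\<Sum>i<n. 1 - score (Y i \<omega> - s x n))"
        by (simp add: sum_subtractf algebra_simps)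
      also have "\<dots> = (\<Sum>i = 1..n. 1 - score (X i \<omega> - s x n))"
        by (simp add: Y_def sum.atLeast1_atMost_eq)
      finally have sum: "(\<Sum>i = 1..n. 1 - score (X i \<omega> - s x n)) = sqrt (real n) * (c x n - Z x n \<omega>)" ..
      have "tn n \<omega> - s x n = (\<tau> n \<omega> - x) / sqrt (real n)"
        using n by (simp add: \<tau>_def s_def field_simps)
      with le show ?case
        unfolding sum using n by simp
    qed
  qed

  have "weak_conv_m (\<lambda>n. distr M borel (\<tau> n)) (distr (normal_law 0 v) borel (\<lambda>y. y / - D))"
  proof (rule weak_conv_m_by_inversion[OF real_distribution_normal_law _ _ _ Z_conv c_lim])
    show "- D > 0" using D_neg by simp
    show "\<forall>\<^sub>F n in sequentially. \<tau> n \<in> borel_measurable M"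
      using eventually_ge_at_top[of 1]
      by eventually_elim (use tn_rv in \<open>simp add: \<tau>_def[abs_def]\<close>)
    show "Z x n \<in> borel_measurable M" for x n
      unfolding Z_def[abs_def] by measurable
    show "\<forall>\<^sub>F n in sequentially. AE \<omega> in M. Z x n \<omega> < c x n \<longrightarrow> \<tau> n \<omega> \<le> x" for x
      using eventually_ge_at_top[of 1] s_U[of x]
    proof eventually_elim
      case (elim n)
      from mono_score[OF elim] show ?case
        by eventually_elim (auto simp: mult_le_0_iff)
    qed
    show "\<forall>\<^sub>F n in sequentially. AE \<omega> in M. \<tau> n \<omega> < x \<longrightarrow> Z x n \<omega> \<le> c x n" for x
      using eventually_ge_at_top[of 1] s_U[of x]
    proof eventually_elim
      case (elim n)
      from mono_score[OF elim] show ?case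
        by eventually_elim (auto simp: mult_le_0_iff)
    qed
  qed
  moreover have "distr (normal_law 0 v) borel (\<lambda>y. y / - D) = normal_law 0 \<sigma>2"
    using normal_law_divide[of "- D" v] D_neg by (simp add: sigma2_eq var_eq v_def)
  ultimately show ?thesis
    by (simp add: \<tau>_def[abs_def])
qed

end
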